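(* Let $f_1,\dots,f_n$ be non-constant entire functions on $\mathbb{C}^m$ with $m(r,f_i/f_1)=S(r,f_1)$ for each $i=1,\dots,n$. Let $$G(w_1,\dots,w_n)=\sum_{|I|=0}^{\infty}a_I(z)\,w_1^{i_1}\cdots w_n^{i_n}$$ be a nonzero power series in $w=(w_1,\dots,w_n)$ whose coefficients $a_I$ are entire functions on $\mathbb{C}^m$ satisfying $m\big(r,\sum_{|I|\ge0}|a_I|\big)=S(r,f_1)$, and such that $G(z,f_1(z),\dots,f_n(z))$ converges for all $z$. If $\delta(0,f_1)>0$ and $G(f_1,\dots,f_n)\equiv0$, then there exists a nonzero polynomial $P(w_1,\dots,w_n)$ whose coefficients are polynomials in some of the $a_I$ (hence small functions of $f_1$) such that $P(f_1,\dots,f_n)\equiv0$.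
   Context: Multi-index $I=(i_1,\dots,i_n)$ with $|I|=i_1+\dots+i_n$ and $w^I=w_1^{i_1}\cdots w_n^{i_n}$. Nevanlinna theory on $\mathbb{C}^m$: $m(r,\varphi)$ is the average of $\log^+|\varphi|$ over the sphere of radius $r$ (defined likewise for a nonnegative function $\varphi$ such as $\sum|a_I|$), $T(r,f)$ the characteristic, $\delta(0,f)=\liminf_{r\to\infty}m(r,1/f)/T(r,f)$. $S(r,f)$ denotes any quantity $o(T(r,f))$ as $r\to\infty$ outside a possible exceptional set of finite linear measure; a small function of $f$ is a meromorphic $b$ with $T(r,b)=S(r,f)$. *)

theory Defs
  imports "HOL-Analysis.Analysis"
begin

definition entire_m :: "(complex^'m \<Rightarrow> complex) \<Rightarrow> bool" where
  "entire_m f \<longleftrightarrow>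
     (\<forall>z. \<exists>L. (f has_derivative L) (at z) \<and> (\<forall>c x. L (c *s x) = c * L x))"

definition nonconstant :: "('a \<Rightarrow> 'b) \<Rightarrow> bool" where
  "nonconstant f \<longleftrightarrow> \<not> (\<exists>c. \<forall>z. f z = c)"

definition lnplus :: "ennreal \<Rightarrow> ennreal" where
  "lnplus x = (if x = \<infinity> then \<infinity> else ennreal (max 0 (ln (enn2real x))))"

text \<open>Average of log^+ phi over the sphere of radius r, with respect to the normalized
  (rotation invariant) surface measure.  The normalized surface measure of A on the unit
  sphere equals the normalized volume of the cone {t x. 0 < t \<le> 1, x \<in> A}; hence the
  average is written as an integral over the unit ball of the radial projection.\<close>
definition prox_nn :: "real \<Rightarrow> (complex^'m \<Rightarrow> ennreal) \<Rightarrow> ennreal" where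
  "prox_nn r \<phi> =
     (\<integral>\<^sup>+ x \<in> ball 0 1. lnplus (\<phi> ((r / norm x) *\<^sub>R x)) \<partial>lborel)
       / emeasure lborel (ball (0::complex^'m) 1)"

definition prox :: "real \<Rightarrow> (complex^'m \<Rightarrow> complex) \<Rightarrow> real" where
  "prox r f = enn2real (prox_nn r (\<lambda>z. ennreal (cmod (f z))))"

text \<open>Nevanlinna characteristic.  All functions to which it is applied are entire
  (no poles), so T(r,f) = m(r,f) + N(r,\<infinity>,f) = m(r,f).\<close>
definition char_T :: "real \<Rightarrow> (complex^'m \<Rightarrow> complex) \<Rightarrow> real" where
  "char_T r f = prox r f"

definition defect0 :: "(complex^'m \<Rightarrow> complex) \<Rightarrow> ereal" where
  "defect0 f = Liminf at_top (\<lambda>r. ereal (prox r (\<lambda>z. inverse (f z)) / char_T r f))"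

definition is_S :: "(complex^'m \<Rightarrow> complex) \<Rightarrow> (real \<Rightarrow> real) \<Rightarrow> bool" where
  "is_S f g \<longleftrightarrow> (\<exists>E. E \<in> sets lebesgue \<and> emeasure lebesgue E < \<infinity> \<and>
      ((\<lambda>r. g r / char_T r f) \<longlongrightarrow> 0) (inf at_top (principal (- E))))"

text \<open>Multi-indices I = (i_1,...,i_n) represented as functions nat \<Rightarrow> nat vanishing
  from position n on (positions 0..n-1 correspond to 1..n).\<close>
definition multi_idx :: "nat \<Rightarrow> (nat \<Rightarrow> nat) set" where
  "multi_idx n = {I. \<forall>k\<ge>n. I k = 0}"

definition mdeg :: "nat \<Rightarrow> (nat \<Rightarrow> nat) \<Rightarrow> nat" where
  "mdeg n I = (\<Sum>k<n. I k)"

definition mpow :: "nat \<Rightarrow> (nat \<Rightarrow> 'a::comm_ring_1) \<Rightarrow> (nat \<Rightarrow> nat) \<Rightarrow> 'a" where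
  "mpow n w I = (\<Prod>k<n. w k ^ I k)"

definition ps_part :: "nat \<Rightarrow> ((nat \<Rightarrow> nat) \<Rightarrow> 'x \<Rightarrow> complex) \<Rightarrow> 'x \<Rightarrow> (nat \<Rightarrow> complex) \<Rightarrow> nat \<Rightarrow> complex" where
  "ps_part n a z w d = (\<Sum>I\<in>{I\<in>multi_idx n. mdeg n I = d}. a I z * mpow n w I)"

inductive_set poly_ring_of :: "('x \<Rightarrow> complex) set \<Rightarrow> ('x \<Rightarrow> complex) set"
  for A where
    gen: "g \<in> A \<Longrightarrow> g \<in> poly_ring_of A"
  | const: "(\<lambda>z. c) \<in> poly_ring_of A"
  | add: "g \<in> poly_ring_of A \<Longrightarrow> h \<in> poly_ring_of A \<Longrightarrow> (\<lambda>z. g z + h z) \<in> poly_ring_of A"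
  | mult: "g \<in> poly_ring_of A \<Longrightarrow> h \<in> poly_ring_of A \<Longrightarrow> (\<lambda>z. g z * h z) \<in> poly_ring_of A"

end

theory Submission
  imports Defs "HOL-Complex_Analysis.Complex_Analysis" "HOL-Library.Function_Algebras"
begin

text \<open>Write \<open>f = f\<^sub>1\<close> and let \<open>G\<close> vanish at \<open>(f\<^sub>1, \<dots>, f\<^sub>n)\<close>.  For every \<open>\<kappa>\<close> a dimension count yields a polynomial
  multiplier \<open>R\<close>, with coefficients polynomial in the \<open>a\<^sub>I\<close>, such that \<open>R * G = P + O(|w| ^ N)\<close> with \<open>P \<noteq> 0\<close> of degree
  less than \<open>x\<close> and \<open>N = \<kappa> * x\<close>.  Where \<open>f\<close> is small, \<open>P(f\<^sub>1, \<dots>, f\<^sub>n)\<close> is therefore of size \<open>|f| ^ N\<close> up to small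
  functions, so \<open>N * m(r, 1/f) \<le> m(r, 1/P(f\<^sub>1, \<dots>, f\<^sub>n)) + S(r, f)\<close>.  If \<open>P(f\<^sub>1, \<dots>, f\<^sub>n)\<close> were not identically zero,
  a Jensen inequality with a lossy constant would bound the right-hand side by \<open>9 * x * T(r, f) + S(r, f)\<close>, which
  contradicts \<open>\<delta>(0, f) > 0\<close> once \<open>\<kappa>\<close> is large.\<close>

section \<open>The Poisson-Jensen inequality in one variable\<close>

text \<open>Truncating \<open>G\<close> itself at degree \<open>N\<close> would not do: the
  polynomial is small of order \<open>N\<close>, but its degree is about \<open>N\<close> as well,
  so both sides of the comparison would grow alike. The multiplier creates a polynomial whose degree
  is smaller than its order of smallness by an arbitrary factor \<kappa>. This freedom also makes
  crude constants harmless: any bound linear in the degree contradicts a positive defect, so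
  Jensen's formula with its counting functions is replaced by two-sided bounds for the Poisson
  kernel. The coefficients of the multiplier must be polynomials in the \<open>a\<^sub>I\<close>,
  not quotients, so the linear system is solved without division over this ring; it is an integral
  domain because nonzero entire functions have null zero sets. Several variables are reduced to
  complex lines by averaging, which rests on the rotation invariance of Lebesgue measure. Bounded
  error terms count as small because the characteristic of a nonconstant entire function tends to
  infinity.\<close>

lemma lnplus_ennreal: "0 \<le> y \<Longrightarrow> lnplus (ennreal y) = ennreal (max 0 (ln y))"
  by (simp add: lnplus_def)

lemma lnplus_top [simp]: "lnplus top = top"
  by (simp add: lnplus_def)

lemma lnplus_0 [simp]: "lnplus 0 = 0"
  by (simp add: lnplus_def)

lemma lnplus_mono: assumes "x \<le> y" shows "lnplus x \<le> lnplus y"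
proof (cases y rule: ennreal_cases)
  case (real r)
  then obtain q where q: "x = ennreal q" "0 \<le> q"
    using assms by (cases x rule: ennreal_cases) (auto simp: top_unique)
  with real assms have "q \<le> r" by simp
  then show ?thesis using q real
    by (cases "q = 0") (auto simp: lnplus_ennreal max_def intro!: ennreal_leI)
qed simp

lemma borel_measurable_lnplus [measurable]: "lnplus \<in> borel_measurable borel"
  unfolding lnplus_def[abs_def] by measurable

lemma tendsto_lnplus:
  assumes "(X \<longlongrightarrow> x) F" shows "((\<lambda>i. lnplus (X i)) \<longlongrightarrow> lnplus x) F"
proof (cases x rule: ennreal_cases)
  case (real r)
  have fin: "\<forall>\<^sub>F i in F. X i < ennreal (r + 1)"
    using assms real by (intro order_tendstoD) (auto simp: ennreal_lessI)
  have "((\<lambda>i. enn2real (X i)) \<longlongrightarrow> r) F"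
    by (rule tendsto_enn2real) (use assms real in auto)
  \<comment> \<open>The inner \<open>max 1\<close> does not change log^+ and keeps \<open>ln\<close>
    away from its singularity, so that \<open>r = 0\<close> is covered.\<close>
  then have "((\<lambda>i. ennreal (max 0 (ln (max 1 (enn2real (X i)))))) \<longlongrightarrow> ennreal (max 0 (ln (max 1 r)))) F"
    by (intro tendsto_ennrealI tendsto_max tendsto_const tendsto_ln) auto
  moreover have eq: "max 0 (ln (max 1 y)) = max 0 (ln y)" if "0 \<le> y" for y :: real
    using that by (cases "y = 0") (auto simp: max_def)
  moreover have "\<forall>\<^sub>F i in F. ennreal (max 0 (ln (max 1 (enn2real (X i))))) = lnplus (X i)"
    using fin by eventually_elim (subst eq, auto simp: lnplus_def)
  ultimately show ?thesis
    using real by (auto simp: lnplus_ennreal intro: Lim_transform_eventually)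
next
  case top
  have "\<forall>\<^sub>F i in F. l < lnplus (X i)" if "l < top" for l
  proof -
    obtain q where q: "l = ennreal q" "0 \<le> q" using \<open>l < top\<close> by (cases l rule: ennreal_cases) auto
    have "\<forall>\<^sub>F i in F. ennreal (exp (q + 1)) < X i"
      using assms top by (intro order_tendstoD) auto
    then show ?thesis
    proof eventually_elim
      case (elim i)
      have "l < lnplus (ennreal (exp (q + 1)))"
        using q by (simp add: lnplus_ennreal ennreal_lessI)
      also have "\<dots> \<le> lnplus (X i)" using elim by (intro lnplus_mono) simp
      finally show ?case .
    qed
  qed
  then show ?thesis using top by (auto intro!: order_tendstoI)
qed

text \<open>Cauchy's formula at \<open>b\<close> for \<open>k\<close>, whose extra factor equals 1
  at \<open>b\<close>. On the unit circle \<open>1 - cnj b * u\<close> is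
  \<open>u * cnj (u - b)\<close>, which turns the Cauchy kernel into the Poisson kernel.\<close>

lemma poisson_formula:
  assumes "q holomorphic_on ball 0 R" "1 < R" "norm b < 1"
  shows "((\<lambda>t. q (cis t) * of_real ((1 - (norm b)\<^sup>2) / (norm (cis t - b))\<^sup>2))
           has_integral (2 * of_real pi * q b)) {0..2 * pi}"
proof -
  define k where "k u = q u * of_real (1 - (norm b)\<^sup>2) / (1 - cnj b * u)" for u
  have sub: "cball 0 1 \<subseteq> ball (0::complex) R" using assms by auto
  have nz: "1 - cnj b * u \<noteq> 0" if "norm u \<le> 1" for u
  proof
    assume "1 - cnj b * u = 0"
    then have "1 = norm (cnj b * u)" by simp
    also have "\<dots> \<le> norm b * 1" unfolding norm_mult using that by (intro mult_mono) auto
    finally show False using assms by simp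
  qed
  have hol: "k holomorphic_on cball 0 1"
    unfolding k_def using nz by (intro holomorphic_intros holomorphic_on_subset[OF assms(1) sub]) auto
  have "((\<lambda>u. k u / (u - b)) has_contour_integral (2 * of_real pi * \<i> * k b)) (circlepath 0 1)"
    using assms hol
    by (intro Cauchy_integral_circlepath holomorphic_on_imp_continuous_on)
       (auto intro: holomorphic_on_subset)
  then have "((\<lambda>t. k (cis t) / (cis t - b) * \<i> * cis t) has_integral (2 * of_real pi * \<i> * k b)) {0..2*pi}"
    by (simp add: circlepath_def has_contour_integral_part_circlepath_iff)
  then have "((\<lambda>t. -\<i> * (k (cis t) / (cis t - b) * \<i> * cis t)) has_integral -\<i> * (2 * of_real pi * \<i> * k b)) {0..2*pi}"
    by (rule has_integral_mult_right)
  moreover have "k b = q b"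
  proof -
    have "1 - cnj b * b = of_real (1 - (norm b)\<^sup>2)"
      by (simp only: of_real_diff of_real_1 complex_norm_square mult.commute)
    moreover have "1 - (norm b)\<^sup>2 \<noteq> 0" using assms(3) norm_ge_zero[of b] by (auto simp: power2_eq_1_iff simp del: norm_ge_zero)
    ultimately show ?thesis unfolding k_def by (metis nonzero_mult_div_cancel_right of_real_eq_0_iff)
  qed
  moreover have "-\<i> * (k (cis t) / (cis t - b) * \<i> * cis t) =
      q (cis t) * of_real ((1 - (norm b)\<^sup>2) / (norm (cis t - b))\<^sup>2)" for t
  proof -
    have 1: "1 - cnj b * cis t = cis t * cnj (cis t - b)"
      by (simp add: algebra_simps cis_cnj flip: cis_mult cis_inverse)
    have 2: "complex_of_real ((norm (cis t - b))\<^sup>2) = (cis t - b) * cnj (cis t - b)"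
      by (rule complex_norm_square)
    have "-\<i> * (x * y / (c * d) / e * \<i> * c) = x * (y / (e * d))" if "c \<noteq> 0" for x y c d e :: complex
      using that by (cases "d = 0"; cases "e = 0") (simp_all add: field_simps)
    from this[OF cis_neq_zero] show ?thesis unfolding k_def 1 of_real_divide 2 .
  qed
  ultimately show ?thesis by (simp add: algebra_simps)
qed

text \<open>Harnack bounds: the kernel lies between \<open>(1 - norm b) / (1 + norm b)\<close> and
  its reciprocal, which are 1/3 and 3 at \<open>norm b = 1/2\<close>. They are the source of the
  factors 9 and \<open>6 * pi\<close> below.\<close>

lemma poisson_kernel_bounds:
  fixes b c :: complex
  assumes "norm b \<le> 1/2" "norm c = 1"
  shows "1/3 \<le> (1 - (norm b)\<^sup>2) / (norm (c - b))\<^sup>2" "(1 - (norm b)\<^sup>2) / (norm (c - b))\<^sup>2 \<le> 3"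
proof -
  let ?x = "norm b" and ?d = "norm (c - b)"
  have d: "1 - ?x \<le> ?d" "?d \<le> 1 + ?x" "0 < ?d"
    using norm_triangle_ineq2[of c b] norm_triangle_ineq4[of c b] assms by auto
  have "?d\<^sup>2 \<le> (1 + ?x)\<^sup>2" using d by (intro power_mono) auto
  also have "\<dots> = (1 + ?x) * (1 + ?x)" by (simp add: power2_eq_square)
  also have "\<dots> \<le> (3 * (1 - ?x)) * (1 + ?x)" using assms by (intro mult_right_mono) auto
  also have "\<dots> = 3 * (1 - ?x\<^sup>2)" by (simp add: power2_eq_square algebra_simps)
  finally show "1/3 \<le> (1 - ?x\<^sup>2) / ?d\<^sup>2" using d by (simp add: field_simps)
  have "1 - ?x\<^sup>2 = (1 + ?x) * (1 - ?x)" by (simp add: power2_eq_square algebra_simps)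
  also have "\<dots> \<le> (3 * (1 - ?x)) * (1 - ?x)" using assms by (intro mult_right_mono) auto
  also have "\<dots> = 3 * (1 - ?x)\<^sup>2" by (simp add: power2_eq_square)
  also have "\<dots> \<le> 3 * ?d\<^sup>2" using d assms by (intro mult_left_mono power_mono) auto
  finally show "(1 - ?x\<^sup>2) / ?d\<^sup>2 \<le> 3" using d by (simp add: field_simps)
qed

lemma lnplus_inverse:
  assumes "0 < y" shows "lnplus (inverse (ennreal y)) = ennreal (max 0 (- ln y))"
  using assms by (simp add: inverse_ennreal lnplus_ennreal ln_inverse)

lemma poisson_jensen_zero_free:
  assumes hol: "g holomorphic_on ball 0 R" and R: "1 < R" and nz: "\<And>z. z \<in> ball 0 R \<Longrightarrow> g z \<noteq> 0"
    and b: "norm b \<le> 1/2"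
  shows "ennreal (2 * pi) * lnplus (ennreal (cmod (g b))) +
           ennreal (1/3) * (\<integral>\<^sup>+t\<in>{0..2*pi}. lnplus (inverse (ennreal (cmod (g (cis t))))) \<partial>lborel)
       \<le> 3 * (\<integral>\<^sup>+t\<in>{0..2*pi}. lnplus (ennreal (cmod (g (cis t)))) \<partial>lborel) +
           ennreal (2 * pi) * lnplus (inverse (ennreal (cmod (g b))))"
proof -
  have inR: "cis t \<in> ball 0 R" "b \<in> ball 0 R" for t using R b by auto
  obtain q where q: "q holomorphic_on ball 0 R" "\<And>z. z \<in> ball 0 R \<Longrightarrow> g z = exp (q z)"
    using contractible_imp_holomorphic_log[OF hol _ nz] convex_imp_contractible[OF convex_ball] by blast
  define P where "P t = (1 - (norm b)\<^sup>2) / (norm (cis t - b))\<^sup>2" for t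
  define u where "u t = Re (q (cis t))" for t
  have lncis: "ln (cmod (g (cis t))) = u t" "0 < cmod (g (cis t))" for t
    using q(2)[OF inR(1)] by (auto simp: u_def)
  have lnb: "ln (cmod (g b)) = Re (q b)" "0 < cmod (g b)"
    using q(2)[OF inR(2)] by auto
  have P: "1/3 \<le> P t" "P t \<le> 3" for t
    using poisson_kernel_bounds[of b "cis t"] b by (auto simp: P_def)
  have "continuous_on UNIV (\<lambda>t. q (cis t))"
    by (rule continuous_on_compose2[OF holomorphic_on_imp_continuous_on[OF q(1)]])
       (use inR in \<open>auto intro!: continuous_intros\<close>)
  then have contu: "continuous_on UNIV u"
    unfolding u_def by (intro continuous_intros)
  have cu: "(\<lambda>t. max 0 (u t)) integrable_on {0..2*pi}" "(\<lambda>t. max 0 (- u t)) integrable_on {0..2*pi}"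
    by (intro integrable_continuous_real continuous_intros continuous_on_subset[OF contu], auto)+
  have "((\<lambda>t. q (cis t) * of_real (P t)) has_integral (2 * of_real pi * q b)) {0..2*pi}"
    unfolding P_def using poisson_formula[OF q(1) R] b by auto
  from has_integral_Re[OF this]
  have 1: "((\<lambda>t. u t * P t) has_integral (2 * pi * Re (q b))) {0..2*pi}"
    by (simp add: u_def)
  have 2: "2 * pi * Re (q b) \<le> 3 * integral {0..2*pi} (\<lambda>t. max 0 (u t)) - 1/3 * integral {0..2*pi} (\<lambda>t. max 0 (- u t))"
  proof (rule has_integral_le[OF 1])
    show "((\<lambda>t. 3 * max 0 (u t) - 1/3 * max 0 (- u t)) has_integral
       3 * integral {0..2*pi} (\<lambda>t. max 0 (u t)) - 1/3 * integral {0..2*pi} (\<lambda>t. max 0 (- u t))) {0..2*pi}"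
      using cu by (intro has_integral_diff has_integral_mult_right integrable_integral)
    fix t
    show "u t * P t \<le> 3 * max 0 (u t) - 1/3 * max 0 (- u t)"
    proof (cases "0 \<le> u t")
      case True then show ?thesis using mult_left_mono[OF P(2)[of t] True] by simp
    next
      case False then have "u t * P t \<le> u t * (1/3)" by (intro mult_left_mono_neg P) auto
      with False show ?thesis by simp
    qed
  qed
  have nn: "(\<integral>\<^sup>+t\<in>{0..2*pi}. lnplus (ennreal (cmod (g (cis t)))) \<partial>lborel) = ennreal (integral {0..2*pi} (\<lambda>t. max 0 (u t)))"
    "(\<integral>\<^sup>+t\<in>{0..2*pi}. lnplus (inverse (ennreal (cmod (g (cis t))))) \<partial>lborel) = ennreal (integral {0..2*pi} (\<lambda>t. max 0 (- u t)))"
    using lncis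
    by (auto simp: lnplus_ennreal lnplus_inverse simp del: integral_unique
        intro!: nn_integral_has_integral_lebesgue' integrable_integral cu)
  have pos: "0 \<le> integral {0..2*pi} (\<lambda>t. max 0 (u t))" "0 \<le> integral {0..2*pi} (\<lambda>t. max 0 (- u t))"
    by (intro integral_nonneg cu; simp)+
  have "2 * pi * max 0 (Re (q b)) + 1/3 * integral {0..2*pi} (\<lambda>t. max 0 (- u t))
     \<le> 3 * integral {0..2*pi} (\<lambda>t. max 0 (u t)) + 2 * pi * max 0 (- Re (q b))"
    using 2 by (auto simp: max_def)
  then have "ennreal (2 * pi * max 0 (Re (q b)) + 1/3 * integral {0..2*pi} (\<lambda>t. max 0 (- u t)))
     \<le> ennreal (3 * integral {0..2*pi} (\<lambda>t. max 0 (u t)) + 2 * pi * max 0 (- Re (q b)))"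
    by (rule ennreal_leI)
  moreover have "ennreal (1/3) * ennreal (integral {0..2*pi} (\<lambda>t. max 0 (- u t))) =
      ennreal (1/3 * integral {0..2*pi} (\<lambda>t. max 0 (- u t)))"
    using pos by (intro ennreal_mult[symmetric]) auto
  ultimately show ?thesis unfolding nn using pos lnb
    by (simp add: lnplus_ennreal lnplus_inverse ennreal_mult ennreal_plus)
qed

lemma lnplus_const_finite: "lnplus (ennreal c) < \<infinity>"
  by (simp add: lnplus_def)

lemma ennreal_inverse_antimono:
  assumes "x \<le> y" shows "inverse y \<le> inverse (x::ennreal)"
proof (cases "x = 0 \<or> y = top")
  case False
  obtain p where p: "x = ennreal p" "0 < p"
    using assms False by (cases x rule: ennreal_cases) (auto simp: top_unique order_le_less)
  moreover obtain q where "y = ennreal q" "0 \<le> q"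
    using False by (cases y rule: ennreal_cases) auto
  moreover from calculation assms have "p \<le> q" by simp
  ultimately have "x = ennreal p" "y = ennreal q" "0 < p" "p \<le> q" by auto
  then show ?thesis by (simp add: inverse_ennreal le_imp_inverse_le)
qed auto

lemma borel_measurable_inverse_ennreal [measurable]: "inverse \<in> borel_measurable (borel :: ennreal measure)"
  using continuous_on_inverse_ennreal[OF continuous_on_id] by (rule borel_measurable_continuous_onI)

lemma tendsto_inverse_ennreal: "(X \<longlongrightarrow> (x::ennreal)) F \<Longrightarrow> ((\<lambda>i. inverse (X i)) \<longlongrightarrow> inverse x) F"
  by (rule continuous_on_tendsto_compose[OF continuous_on_inverse_ennreal[OF continuous_on_id, of UNIV]]) auto

text \<open>Blaschke factors have modulus at most 1: the difference of the squares factors into two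
  nonnegative numbers.\<close>

lemma norm_diff_le_norm_one_minus_cnj:
  assumes "norm b \<le> 1" "norm z \<le> 1"
  shows "norm (b - z) \<le> norm (1 - cnj z * b)"
proof -
  have "(norm (1 - cnj z * b))\<^sup>2 - (norm (b - z))\<^sup>2 = (1 - (norm b)\<^sup>2) * (1 - (norm z)\<^sup>2)"
  proof -
    have "complex_of_real ((norm (1 - cnj z * b))\<^sup>2 - (norm (b - z))\<^sup>2) =
        complex_of_real ((1 - (norm b)\<^sup>2) * (1 - (norm z)\<^sup>2))"
      unfolding of_real_diff of_real_mult of_real_1 complex_norm_square complex_cnj_diff complex_cnj_mult
        complex_cnj_cnj complex_cnj_one by algebra
    then show ?thesis by (simp only: of_real_eq_iff)
  qed
  also have "\<dots> \<ge> 0" using assms by (intro mult_nonneg_nonneg) (simp_all add: power_le_one)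
  finally have "(norm (b - z))\<^sup>2 \<le> (norm (1 - cnj z * b))\<^sup>2" by linarith
  then show ?thesis by (rule power2_le_imp_le) simp
qed

lemma norm_one_minus_cnj_circle:
  assumes "norm c = 1" shows "norm (1 - cnj z * c) = norm (c - z)"
proof -
  have "1 - cnj z * c = c * cnj (c - z)"
    using complex_norm_square[of c] assms by (simp add: algebra_simps)
  then show ?thesis using assms by (simp only: norm_mult complex_mod_cnj mult_1)
qed

text \<open>Zeros may still lie on the unit circle. The dilations \<open>g (s k * w)\<close> have
  none on a larger disc; as \<open>s k\<close> tends to 1, Fatou's lemma handles the left side,
  whose integrand may be unbounded, and dominated convergence the right side, since \<open>g\<close>
  is bounded on the closed disc.\<close>

lemma poisson_jensen_disc_zero_free:
  assumes hol: "g holomorphic_on UNIV" and nz: "\<And>z. z \<in> ball 0 1 \<Longrightarrow> g z \<noteq> 0" and b: "norm b \<le> 1/2"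
  shows "ennreal (2 * pi) * lnplus (ennreal (cmod (g b))) +
           ennreal (1/3) * (\<integral>\<^sup>+t\<in>{0..2*pi}. lnplus (inverse (ennreal (cmod (g (cis t))))) \<partial>lborel)
       \<le> 3 * (\<integral>\<^sup>+t\<in>{0..2*pi}. lnplus (ennreal (cmod (g (cis t)))) \<partial>lborel) +
           ennreal (2 * pi) * lnplus (inverse (ennreal (cmod (g b))))"
proof -
  define s :: "nat \<Rightarrow> real" where "s k = 1 - 1 / (real k + 2)" for k
  have s: "0 < s k" "s k < 1" for k by (auto simp: s_def field_simps)
  have slim: "s \<longlonglongrightarrow> 1" unfolding s_def by real_asymp
  have contg: "continuous_on UNIV g" using hol by (rule holomorphic_on_imp_continuous_on)
  have glim: "(\<lambda>k. g (of_real (s k) * w)) \<longlonglongrightarrow> g w" for w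
    by (rule continuous_on_tendsto_compose[OF contg])
       (auto intro!: tendsto_eq_intros slim)
  have [measurable]: "(\<lambda>t. g (of_real x * cis t)) \<in> borel_measurable borel" for x
    by (intro borel_measurable_continuous_onI continuous_on_compose2[OF contg] continuous_intros) auto
  have [measurable]: "(\<lambda>t. g (cis t)) \<in> borel_measurable borel"
    by (intro borel_measurable_continuous_onI continuous_on_compose2[OF contg] continuous_intros) auto
  have limplus: "(\<lambda>k. lnplus (ennreal (cmod (g (of_real (s k) * w))))) \<longlonglongrightarrow> lnplus (ennreal (cmod (g w)))" 
    and limminus: "(\<lambda>k. lnplus (inverse (ennreal (cmod (g (of_real (s k) * w)))))) \<longlonglongrightarrow> lnplus (inverse (ennreal (cmod (g w))))" for w
    by (intro tendsto_lnplus tendsto_inverse_ennreal tendsto_ennrealI tendsto_norm glim)+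
  let ?L = "\<lambda>k t. (lnplus (ennreal (cmod (g (of_real (s k) * b)))) +
             ennreal (1/3) * lnplus (inverse (ennreal (cmod (g (of_real (s k) * cis t)))))) * indicator {0..2*pi} t"
  let ?R = "\<lambda>k. 3 * (\<integral>\<^sup>+t\<in>{0..2*pi}. lnplus (ennreal (cmod (g (of_real (s k) * cis t)))) \<partial>lborel) +
           ennreal (2 * pi) * lnplus (inverse (ennreal (cmod (g (of_real (s k) * b)))))"
  have split: "(\<integral>\<^sup>+t\<in>{0..2*pi}. c + ennreal (1/3) * h t \<partial>lborel) =
     ennreal (2 * pi) * c + ennreal (1/3) * (\<integral>\<^sup>+t\<in>{0..2*pi}. h t \<partial>lborel)"
    if [measurable]: "h \<in> borel_measurable borel" for c h
  proof -
    have "(\<integral>\<^sup>+t\<in>{0..2*pi}. c + ennreal (1/3) * h t \<partial>lborel) =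
      (\<integral>\<^sup>+t. c * indicator {0..2*pi} t + ennreal (1/3) * (h t * indicator {0..2*pi} t) \<partial>lborel)"
      by (intro nn_integral_cong) (simp add: indicator_def)
    also have "\<dots> = c * ennreal (2 * pi) + ennreal (1/3) * (\<integral>\<^sup>+t\<in>{0..2*pi}. h t \<partial>lborel)"
      by (subst nn_integral_add) (auto simp: nn_integral_cmult)
    finally show ?thesis by (simp add: mult.commute)
  qed
  have LR: "(\<integral>\<^sup>+t. ?L k t \<partial>lborel) \<le> ?R k" for k
  proof -
    have "(\<lambda>z. g (of_real (s k) * z)) holomorphic_on ball 0 (1 / s k)"
      using holomorphic_on_compose_gen[of "\<lambda>z. of_real (s k) * z" "ball 0 (1 / s k)" g UNIV] hol
      by (auto simp: o_def intro!: holomorphic_intros)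
    moreover have "g (of_real (s k) * z) \<noteq> 0" if "z \<in> ball 0 (1 / s k)" for z
      using that s[of k] by (intro nz) (auto simp: norm_mult field_simps)
    moreover have "1 < 1 / s k" using s[of k] by simp
    ultimately show ?thesis using poisson_jensen_zero_free[of "\<lambda>z. g (of_real (s k) * z)" "1 / s k" b] b
      by (subst split) auto
  qed
  have Rlim: "?R \<longlonglongrightarrow> 3 * (\<integral>\<^sup>+t\<in>{0..2*pi}. lnplus (ennreal (cmod (g (cis t)))) \<partial>lborel) +
           ennreal (2 * pi) * lnplus (inverse (ennreal (cmod (g b))))" (is "_ \<longlonglongrightarrow> ?Rlim")
  proof -
    have "bounded (g ` cball 0 1)"
      by (intro compact_imp_bounded compact_continuous_image continuous_on_subset[OF contg]) auto
    then obtain B where B: "\<And>z. z \<in> cball 0 1 \<Longrightarrow> cmod (g z) \<le> B"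
      unfolding bounded_iff by blast
    have "(\<lambda>k. \<integral>\<^sup>+t\<in>{0..2*pi}. lnplus (ennreal (cmod (g (of_real (s k) * cis t)))) \<partial>lborel)
        \<longlonglongrightarrow> (\<integral>\<^sup>+t\<in>{0..2*pi}. lnplus (ennreal (cmod (g (cis t)))) \<partial>lborel)"
    proof (rule nn_integral_dominated_convergence)
      show "(\<integral>\<^sup>+t. lnplus (ennreal B) * indicator {0..2*pi} t \<partial>lborel) < \<infinity>"
        using lnplus_const_finite[of B] by (subst nn_integral_cmult) (auto simp: ennreal_mult_less_top)
      show "AE t in lborel. lnplus (ennreal (cmod (g (of_real (s k) * cis t)))) * indicator {0..2*pi} t
          \<le> lnplus (ennreal B) * indicator {0..2*pi} t" for k
        using s[of k] by (intro AE_I2 mult_right_mono lnplus_mono ennreal_leI B) (auto simp: norm_mult)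
      show "AE t in lborel. (\<lambda>k. lnplus (ennreal (cmod (g (of_real (s k) * cis t)))) * indicator {0..2*pi} t)
          \<longlonglongrightarrow> lnplus (ennreal (cmod (g (cis t)))) * indicator {0..2*pi} t"
        using limplus by (intro AE_I2) (auto simp: indicator_def)
    qed auto
    then show ?thesis by (intro tendsto_add ennreal_tendsto_cmult limminus) auto
  qed
  have "(\<integral>\<^sup>+t\<in>{0..2*pi}. lnplus (ennreal (cmod (g b))) +
             ennreal (1/3) * lnplus (inverse (ennreal (cmod (g (cis t))))) \<partial>lborel)
     = (\<integral>\<^sup>+t. liminf (\<lambda>k. ?L k t) \<partial>lborel)"
  proof (intro nn_integral_cong lim_imp_Liminf[symmetric] sequentially_bot)
    fix t
    have "(\<lambda>k. lnplus (ennreal (cmod (g (of_real (s k) * b)))) +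
             ennreal (1/3) * lnplus (inverse (ennreal (cmod (g (of_real (s k) * cis t)))))) \<longlonglongrightarrow>
         lnplus (ennreal (cmod (g b))) + ennreal (1/3) * lnplus (inverse (ennreal (cmod (g (cis t)))))"
      by (intro tendsto_add ennreal_tendsto_cmult limplus limminus) auto
    then show "(\<lambda>k. ?L k t) \<longlonglongrightarrow> (lnplus (ennreal (cmod (g b))) +
             ennreal (1/3) * lnplus (inverse (ennreal (cmod (g (cis t)))))) * indicator {0..2*pi} t"
      by (auto simp: indicator_def)
  qed
  also have "\<dots> \<le> liminf (\<lambda>k. \<integral>\<^sup>+t. ?L k t \<partial>lborel)"
    by (rule nn_integral_liminf) simp
  also have "\<dots> \<le> liminf ?R" by (intro Liminf_mono always_eventually allI LR)
  also have "\<dots> = ?Rlim" by (intro lim_imp_Liminf Rlim sequentially_bot)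
  finally show ?thesis by (subst (asm) split) auto
qed

text \<open>A zero \<open>z\<close> in the disc is removed by replacing the factor \<open>w - z\<close> by \<open>1 - cnj z * w\<close>, which has
  the same modulus on the unit circle and larger modulus inside.\<close>
lemma poisson_jensen:
  assumes hol: "g holomorphic_on UNIV" and b: "norm b \<le> 1/2"
  shows "ennreal (2 * pi) * lnplus (ennreal (cmod (g b))) +
           ennreal (1/3) * (\<integral>\<^sup>+t\<in>{0..2*pi}. lnplus (inverse (ennreal (cmod (g (cis t))))) \<partial>lborel)
       \<le> 3 * (\<integral>\<^sup>+t\<in>{0..2*pi}. lnplus (ennreal (cmod (g (cis t)))) \<partial>lborel) +
           ennreal (2 * pi) * lnplus (inverse (ennreal (cmod (g b))))"
proof (cases "g b = 0")
  \<comment> \<open>The right side is infinite, because \<open>inverse 0\<close> is infinite for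
    extended reals.\<close>
  case True then show ?thesis by (simp add: ennreal_mult_top)
next
  case False
  have fin: "finite {z \<in> ball 0 1. g z = 0}" if hol: "g holomorphic_on UNIV" and "g b \<noteq> 0" for g
  proof (cases "g constant_on UNIV")
    case True
    then have "{z \<in> ball 0 1. g z = 0} = {}" using that by (auto simp: constant_on_def)
    then show ?thesis by (metis finite.emptyI)
  next
    case False
    then have "finite {z \<in> cball 0 1. g z = 0}"
      using hol by (intro holomorphic_compact_finite_zeros[of g UNIV]) auto
    then show ?thesis by (rule rev_finite_subset) auto
  qed
  show ?thesis using hol False
  proof (induction "card {z \<in> ball 0 1. g z = 0}" arbitrary: g rule: less_induct)
    case less
    note hol = less.prems(1)
    show ?case
    proof (cases "{z \<in> ball 0 1. g z = 0} = {}")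
      case True
      then show ?thesis by (intro poisson_jensen_disc_zero_free hol b) auto
    next
      case False
      then obtain z where z: "norm z < 1" "g z = 0" by auto
      define k where "k = nat (zorder g z)"
      define h where "h = zor_poly g z"
      have gex: "\<exists>w\<in>UNIV. g w \<noteq> 0" using less.prems(2) by auto
      obtain r where r: "r > 0" "h holomorphic_on cball z r"
        "\<And>w. w \<in> cball z r \<Longrightarrow> g w = h w * (w - z) ^ k \<and> h w \<noteq> 0" and k: "k > 0"
        using zorder_exist_zero[OF hol open_UNIV connected_UNIV UNIV_I gex, of z] z
        unfolding k_def h_def by auto
      \<comment> \<open>\<open>g1\<close> is \<open>g\<close> with the zero at \<open>z\<close>
        divided out in full multiplicity; it agrees with \<open>zor_poly\<close> near
        \<open>z\<close> and with the quotient elsewhere, so it is entire. Removing the full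
        multiplicity at once lowers the number of distinct zeros.\<close>
      define g1 where "g1 w = (if w = z then h z else g w / (w - z) ^ k)" for w
      have g1h: "g1 w = h w" if "w \<in> cball z r" for w
        using r(3)[OF that] by (simp add: g1_def)
      have g: "g w = (w - z) ^ k * g1 w" for w using z k by (simp add: g1_def)
      have "g1 holomorphic_on ball z r"
        by (rule holomorphic_transform[of h]) (use g1h in \<open>auto intro: holomorphic_on_subset[OF r(2)]\<close>)
      moreover have "g1 holomorphic_on - {z}"
        by (rule holomorphic_transform[of "\<lambda>w. g w / (w - z) ^ k"])
           (auto simp: g1_def intro!: holomorphic_intros holomorphic_on_subset[OF hol])
      ultimately have "g1 holomorphic_on (ball z r \<union> - {z})"
        by (intro holomorphic_on_Un) auto
      moreover have "ball z r \<union> - {z} = UNIV" using r(1) by auto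
      ultimately have g1hol: "g1 holomorphic_on UNIV" by simp
      define g2 where "g2 w = (1 - cnj z * w) ^ k * g1 w" for w
      have g2hol: "g2 holomorphic_on UNIV"
        unfolding g2_def by (intro holomorphic_intros g1hol)
      have circ: "cmod (g2 (cis t)) = cmod (g (cis t))" for t
        by (simp add: g g2_def norm_mult norm_power norm_one_minus_cnj_circle)
      have gb: "cmod (g b) \<le> cmod (g2 b)"
        unfolding g g2_def norm_mult norm_power using z b
        by (intro mult_right_mono power_mono norm_diff_le_norm_one_minus_cnj) auto
      then have g2b: "g2 b \<noteq> 0" using less.prems(2) by auto
      have "1 - cnj z * w \<noteq> 0" if "norm w < 1" for w
      proof
        assume "1 - cnj z * w = 0"
        then have "1 = norm z * norm w" by (metis complex_mod_cnj eq_iff_diff_eq_0 norm_mult norm_one)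
        moreover have "norm z * norm w < 1 * 1" using z that by (intro mult_strict_mono') auto
        ultimately show False by simp
      qed
      then have "{w \<in> ball 0 1. g2 w = 0} \<subseteq> {w \<in> ball 0 1. g w = 0}"
        by (auto simp: g g2_def)
      moreover have "g1 z \<noteq> 0" using g1h[of z] r by simp
      then have "g2 z \<noteq> 0" using z \<open>\<And>w. norm w < 1 \<Longrightarrow> 1 - cnj z * w \<noteq> 0\<close> by (auto simp: g2_def)
      ultimately have "{w \<in> ball 0 1. g2 w = 0} \<subset> {w \<in> ball 0 1. g w = 0}"
        using z by auto
      then have "card {w \<in> ball 0 1. g2 w = 0} < card {w \<in> ball 0 1. g w = 0}"
        by (intro psubset_card_mono fin hol less.prems)
      from less.hyps[OF this g2hol g2b, unfolded circ]
      have IH: "ennreal (2 * pi) * lnplus (ennreal (cmod (g2 b))) +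
           ennreal (1/3) * (\<integral>\<^sup>+t\<in>{0..2*pi}. lnplus (inverse (ennreal (cmod (g (cis t))))) \<partial>lborel)
       \<le> 3 * (\<integral>\<^sup>+t\<in>{0..2*pi}. lnplus (ennreal (cmod (g (cis t)))) \<partial>lborel) +
           ennreal (2 * pi) * lnplus (inverse (ennreal (cmod (g2 b))))" .
      have mono: "lnplus (ennreal (cmod (g b))) \<le> lnplus (ennreal (cmod (g2 b)))"
        "lnplus (inverse (ennreal (cmod (g2 b)))) \<le> lnplus (inverse (ennreal (cmod (g b))))"
        by (simp_all add: lnplus_mono ennreal_inverse_antimono ennreal_leI gb)
      show ?thesis
        by (rule order.trans[OF add_right_mono order.trans[OF IH add_left_mono]])
           (rule mult_left_mono; fact mono zero_le)+
    qed
  qed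
qed

section \<open>Averaging over circles in complex space\<close>

lemma nn_integral_lborel_shift:
  fixes F :: "'a::euclidean_space \<Rightarrow> ennreal"
  assumes [measurable]: "F \<in> borel_measurable borel"
  shows "(\<integral>\<^sup>+x. F (c + x) \<partial>lborel) = (\<integral>\<^sup>+x. F x \<partial>lborel)"
proof -
  have "(\<integral>\<^sup>+x. F x \<partial>lborel) = (\<integral>\<^sup>+x. F x \<partial>(distr lborel borel ((+) c)))"
    by (simp add: lborel_distr_plus)
  also have "\<dots> = (\<integral>\<^sup>+x. F (c + x) \<partial>lborel)"
    by (subst nn_integral_distr) auto
  finally show ?thesis ..
qed

lemma nn_integral_lborel_reflect:
  fixes F :: "'a::euclidean_space \<Rightarrow> ennreal"
  assumes [measurable]: "F \<in> borel_measurable borel"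
  shows "(\<integral>\<^sup>+x. F (c - x) \<partial>lborel) = (\<integral>\<^sup>+x. F x \<partial>lborel)"
proof -
  have "(\<integral>\<^sup>+x. F x \<partial>lborel) = (\<integral>\<^sup>+x. F x \<partial>(distr lborel borel (\<lambda>x. c - x)))"
    by (subst lborel_affine[of "-1" c]) (auto simp: density_1)
  also have "\<dots> = (\<integral>\<^sup>+x. F (c - x) \<partial>lborel)"
    by (subst nn_integral_distr) auto
  finally show ?thesis ..
qed

lemma sets_borel_ball [measurable]: "ball x r \<in> sets borel"
  by simp

lemma emeasure_unit_ball:
  "emeasure lborel (ball (0::'a::euclidean_space) 1) \<noteq> 0" "emeasure lborel (ball (0::'a) 1) \<noteq> top"
proof -
  have "0 < unit_ball_vol (real DIM('a))" by (rule unit_ball_vol_pos) simp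
  then show "emeasure lborel (ball (0::'a) 1) \<noteq> 0" "emeasure lborel (ball (0::'a) 1) \<noteq> top"
    by (simp_all add: emeasure_ball ennreal_eq_0_iff not_le del: unit_ball_vol_pos)
qed

text \<open>Integrating \<open>indicator A (R u) * indicator B (R u + y)\<close> over \<open>u\<close> and \<open>y\<close> in both orders, with
  \<open>B\<close> the unit ball, shows that the image measure under \<open>R\<close> is Lebesgue measure.\<close>
lemma lborel_distr_isometry:
  fixes R :: "'a::euclidean_space \<Rightarrow> 'a"
  assumes lin: "linear R" and iso: "\<And>x. norm (R x) = norm x" and surj: "surj R"
  shows "distr lborel borel R = lborel"
proof (rule measure_eqI)
  have [measurable]: "R \<in> borel_measurable borel"
    using lin by (intro borel_measurable_continuous_onI linear_continuous_on) (simp add: linear_conv_bounded_linear)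
  let ?B = "ball (0::'a) 1"
  fix A assume "A \<in> sets (distr lborel borel R)"
  then have [measurable]: "A \<in> sets borel" by simp
  define v where "v = emeasure lborel ?B"
  have v: "v \<noteq> 0" "v \<noteq> top"
    unfolding v_def by (rule emeasure_unit_ball)+
  have "(\<integral>\<^sup>+y. \<integral>\<^sup>+u. indicator A (R u) * indicator ?B (R u + y) \<partial>lborel \<partial>lborel) =
      (\<integral>\<^sup>+u. \<integral>\<^sup>+y. indicator A (R u) * indicator ?B (R u + y) \<partial>lborel \<partial>lborel)"
    by (rule lborel_pair.Fubini') simp
  also have "\<dots> = (\<integral>\<^sup>+u. indicator A (R u) * v \<partial>lborel)"
    by (simp add: nn_integral_cmult nn_integral_lborel_shift v_def)
  also have "\<dots> = (\<integral>\<^sup>+u. indicator A (R u) \<partial>lborel) * v"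
    by (simp add: nn_integral_multc)
  also have "(\<integral>\<^sup>+u. indicator A (R u) \<partial>lborel) = emeasure (distr lborel borel R) A"
    by (subst nn_integral_indicator[symmetric], simp, subst nn_integral_distr) simp_all
  finally have 1: "(\<integral>\<^sup>+y. \<integral>\<^sup>+u. indicator A (R u) * indicator ?B (R u + y) \<partial>lborel \<partial>lborel) =
    emeasure (distr lborel borel R) A * v" .
  have "(\<integral>\<^sup>+u. indicator A (R u) * indicator ?B (R u + y) \<partial>lborel) =
     (\<integral>\<^sup>+u. indicator A (R u - y) * indicator ?B u \<partial>lborel)" for y
  proof -
    \<comment> \<open>Shifting \<open>u\<close> by a preimage of \<open>y\<close> moves the
      translation from the ball to \<open>A\<close>; the isometry then frees the ball condition from
      \<open>R\<close>.\<close>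
    obtain y' where y': "R y' = y" using surj by (metis surjD)
    have "(\<integral>\<^sup>+u. indicator A (R u) * indicator ?B (R u + y) \<partial>lborel) =
       (\<integral>\<^sup>+u. indicator A (R (- y' + u)) * indicator ?B (R (- y' + u) + y) \<partial>lborel)"
      by (rule nn_integral_lborel_shift[symmetric]) simp
    also have "\<dots> = (\<integral>\<^sup>+u. indicator A (R u - y) * indicator ?B u \<partial>lborel)"
      using y' by (intro nn_integral_cong) (simp add: linear_diff[OF lin] iso indicator_def)
    finally show ?thesis .
  qed
  then have "emeasure (distr lborel borel R) A * v =
     (\<integral>\<^sup>+y. \<integral>\<^sup>+u. indicator A (R u - y) * indicator ?B u \<partial>lborel \<partial>lborel)"
    using 1 by simp
  also have "\<dots> = (\<integral>\<^sup>+u. \<integral>\<^sup>+y. indicator A (R u - y) * indicator ?B u \<partial>lborel \<partial>lborel)"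
    by (rule lborel_pair.Fubini') simp
  also have "\<dots> = (\<integral>\<^sup>+u. emeasure lborel A * indicator ?B u \<partial>lborel)"
    by (simp add: nn_integral_multc nn_integral_lborel_reflect)
  also have "\<dots> = emeasure lborel A * v"
    by (simp add: nn_integral_cmult v_def)
  finally show "emeasure (distr lborel borel R) A = emeasure lborel A"
    using v by (simp add: ennreal_mult_cancel_left mult.commute[of _ v])
qed simp

lemma norm_vector_scalar_mult: "norm (c *s x) = norm c * norm (x :: complex^'m)"
  by (simp add: norm_vec_def norm_mult L2_set_right_distrib)

lemma scaleR_eq_vector_scalar_mult: "r *\<^sub>R x = of_real r *s (x :: complex^'m)"
  by (simp add: vec_eq_iff scaleR_conv_of_real[where 'a=complex])

lemma continuous_on_vector_scalar_mult [continuous_intros]: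
  fixes g :: "'b::topological_space \<Rightarrow> complex^'m"
  assumes "continuous_on S f" "continuous_on S g"
  shows "continuous_on S (\<lambda>x. f x *s g x)"
  unfolding vector_scalar_mult_def using assms
  by (intro continuous_on_vec_lambda continuous_intros)

lemma borel_measurable_vector_scalar_mult [measurable (raw)]:
  fixes g :: "'b \<Rightarrow> complex^'m"
  assumes "f \<in> borel_measurable M" "g \<in> borel_measurable M"
  shows "(\<lambda>x. f x *s g x) \<in> borel_measurable M"
  using assms by (rule borel_measurable_continuous_Pair) (intro continuous_intros)

text \<open>Multiplication by \<open>cis t\<close> preserves Lebesgue measure and the ball, so every
  \<open>t\<close> contributes the same integral, and Tonelli's theorem moves the circle integral
  inside. Averages over balls and spheres thus reduce to functions of one variable on complex
  lines.\<close>

lemma nn_integral_ball_circle_average: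
  fixes F :: "complex^'m \<Rightarrow> ennreal"
  assumes [measurable]: "F \<in> borel_measurable borel"
  shows "ennreal (2 * pi) * (\<integral>\<^sup>+x\<in>ball 0 \<rho>. F x \<partial>lborel) =
    (\<integral>\<^sup>+x\<in>ball 0 \<rho>. (\<integral>\<^sup>+t\<in>{0..2*pi}. F (cis t *s x) \<partial>lborel) \<partial>lborel)"
proof -
  have [measurable]: "(*s) c \<in> borel_measurable (borel :: (complex^'m) measure)" for c
    by (intro borel_measurable_continuous_onI continuous_intros)
  have [measurable]: "cis \<in> borel_measurable borel"
    by (intro borel_measurable_continuous_onI continuous_intros)
  have rot: "(\<integral>\<^sup>+x\<in>ball 0 \<rho>. F (cis t *s x) \<partial>lborel) = (\<integral>\<^sup>+x\<in>ball 0 \<rho>. F x \<partial>lborel)" for t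
  proof -
    have "distr lborel borel (\<lambda>x::complex^'m. cis t *s x) = lborel"
    proof (rule lborel_distr_isometry)
      show "linear ((*s) (cis t) :: complex^'m \<Rightarrow> _)"
        by (intro linearI) (auto simp: vec_eq_iff algebra_simps)
      have "y = cis t *s (cis (-t) *s y)" for y :: "complex^'m"
        by (simp add: vector_smult_assoc cis_mult)
      then show "surj ((*s) (cis t) :: complex^'m \<Rightarrow> _)" by (metis surjI)
    qed (simp add: norm_vector_scalar_mult)
    then have "(\<integral>\<^sup>+x\<in>ball 0 \<rho>. F x \<partial>lborel) = (\<integral>\<^sup>+x\<in>ball 0 \<rho>. F x \<partial>(distr lborel borel (\<lambda>x::complex^'m. cis t *s x)))"
      by simp
    also have "\<dots> = (\<integral>\<^sup>+x. F (cis t *s x) * indicator (ball 0 \<rho>) (cis t *s x) \<partial>lborel)"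
      by (subst nn_integral_distr) simp_all
    also have "\<dots> = (\<integral>\<^sup>+x\<in>ball 0 \<rho>. F (cis t *s x) \<partial>lborel)"
      by (intro nn_integral_cong) (simp add: indicator_def norm_vector_scalar_mult)
    finally show ?thesis ..
  qed
  have "(\<integral>\<^sup>+x\<in>ball 0 \<rho>. (\<integral>\<^sup>+t\<in>{0..2*pi}. F (cis t *s x) \<partial>lborel) \<partial>lborel) =
     (\<integral>\<^sup>+x. \<integral>\<^sup>+t. F (cis t *s x) * indicator {0..2*pi} t * indicator (ball 0 \<rho>) x \<partial>lborel \<partial>lborel)"
    by (intro nn_integral_cong nn_integral_multc[symmetric]) simp
  also have "\<dots> = (\<integral>\<^sup>+t. \<integral>\<^sup>+x. F (cis t *s x) * indicator {0..2*pi} t * indicator (ball 0 \<rho>) x \<partial>lborel \<partial>lborel)"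
    by (rule lborel_pair.Fubini') measurable
  also have "\<dots> = (\<integral>\<^sup>+t. (\<integral>\<^sup>+x\<in>ball 0 \<rho>. F (cis t *s x) \<partial>lborel) * indicator {0..2*pi} t \<partial>lborel)"
    by (intro nn_integral_cong, subst nn_integral_multc[symmetric]) (auto simp: ac_simps)
  also have "\<dots> = (\<integral>\<^sup>+t. (\<integral>\<^sup>+x\<in>ball 0 \<rho>. F x \<partial>lborel) * indicator {0..2*pi} t \<partial>lborel)"
    by (simp add: rot)
  also have "\<dots> = ennreal (2 * pi) * (\<integral>\<^sup>+x\<in>ball 0 \<rho>. F x \<partial>lborel)"
    by (subst nn_integral_cmult) (auto simp: mult.commute)
  finally show ?thesis ..
qed

section \<open>Jensen inequalities for entire functions of several variables\<close>

text \<open>Multiplication by 3 clears the kernel bound 1/3; this gives \<open>9 = 3 * 3\<close> and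
  \<open>6 * pi = 3 * (2 * pi)\<close>.\<close>

lemma poisson_jensen_minus:
  assumes hol: "g holomorphic_on UNIV" and b: "norm b \<le> 1/2"
  shows "(\<integral>\<^sup>+t\<in>{0..2*pi}. lnplus (inverse (ennreal (cmod (g (cis t))))) \<partial>lborel)
       \<le> 9 * (\<integral>\<^sup>+t\<in>{0..2*pi}. lnplus (ennreal (cmod (g (cis t)))) \<partial>lborel) +
           ennreal (6 * pi) * lnplus (inverse (ennreal (cmod (g b))))" (is "?I \<le> 9 * ?J + _ * ?K")
proof -
  have third: "3 * ennreal (1/3) = 1"
    using ennreal_mult[of 3 "1/3"] by simp
  have "ennreal (1/3) * ?I \<le> 3 * ?J + ennreal (2 * pi) * ?K"
    by (rule order.trans[OF _ poisson_jensen[OF assms]]) simp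
  then have "3 * (ennreal (1/3) * ?I) \<le> 3 * (3 * ?J + ennreal (2 * pi) * ?K)"
    by (rule mult_left_mono) simp
  also have "3 * (ennreal (1/3) * ?I) = ?I" by (simp add: third flip: mult.assoc)
  also have "3 * (3 * ?J + ennreal (2 * pi) * ?K) = 9 * ?J + 3 * ennreal (2 * pi) * ?K"
    by (simp add: distrib_left mult.assoc flip: mult.assoc[of 3 3])
  also have "3 * ennreal (2 * pi) = ennreal (6 * pi)"
    by (simp add: ennreal_mult' flip: mult.assoc)
  finally show ?thesis .
qed

text \<open>Only \<open>cmod (g b) > 1\<close> needs an argument, and then the negative term at
  \<open>b\<close> vanishes.\<close>

lemma poisson_jensen_plus:
  assumes hol: "g holomorphic_on UNIV" and b: "norm b \<le> 1/2"
  shows "ennreal (2 * pi) * lnplus (ennreal (cmod (g b)))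
       \<le> 3 * (\<integral>\<^sup>+t\<in>{0..2*pi}. lnplus (ennreal (cmod (g (cis t)))) \<partial>lborel)"
proof (cases "cmod (g b) \<le> 1")
  case True
  then have "ln (cmod (g b)) \<le> 0" by (cases "g b = 0") auto
  then show ?thesis by (simp add: lnplus_ennreal max_def)
next
  case False
  then have "lnplus (inverse (ennreal (cmod (g b)))) = 0"
    by (subst lnplus_inverse) (auto simp: max_absorb1)
  with order.trans[OF _ poisson_jensen[OF assms], of "ennreal (2 * pi) * lnplus (ennreal (cmod (g b)))"]
  show ?thesis by simp
qed

section \<open>Entire functions of several variables and their zero sets\<close>

lemma entire_m_line:
  assumes "entire_m h" shows "(\<lambda>t. h (a + t *s x)) holomorphic_on UNIV"
proof (rule holomorphic_onI)
  fix t :: complex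
  obtain L where L: "(h has_derivative L) (at (a + t *s x))" "\<And>c x. L (c *s x) = c * L x"
    using assms unfolding entire_m_def by blast
  have "((\<lambda>t. a + t *s x) has_derivative (\<lambda>u. u *s x)) (at t)"
  proof -
    have "bounded_linear (\<lambda>u. u *s x)"
      by (intro linear_conv_bounded_linear[THEN iffD1] linearI)
        (auto simp: vec_eq_iff algebra_simps)
    from has_derivative_add[OF has_derivative_const bounded_linear_imp_has_derivative[OF this]]
    show ?thesis by simp
  qed
  then have "((\<lambda>t. h (a + t *s x)) has_derivative (\<lambda>u. L (u *s x))) (at t)"
    using L(1) by (rule has_derivative_compose)
  then have "((\<lambda>t. h (a + t *s x)) has_field_derivative L x) (at t)"
    by (simp add: has_field_derivative_def L(2) mult.commute[of _ "L x"])
  then show "(\<lambda>t. h (a + t *s x)) field_differentiable at t within UNIV"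
    by (auto simp: field_differentiable_def)
qed

lemma entire_m_line0:
  assumes "entire_m h" shows "(\<lambda>t. h (t *s x)) holomorphic_on UNIV"
  using entire_m_line[OF assms, of 0 x] by simp

lemma entire_m_continuous: "entire_m h \<Longrightarrow> continuous_on S h"
  unfolding entire_m_def by (blast intro: continuous_at_imp_continuous_on has_derivative_continuous)

lemma entire_m_measurable [measurable_dest]: "entire_m h \<Longrightarrow> h \<in> borel_measurable borel"
  by (intro borel_measurable_continuous_onI entire_m_continuous)

lemma entire_m_const: "entire_m (\<lambda>z. c)"
  unfolding entire_m_def by (intro allI exI[of _ "\<lambda>_. 0"]) auto

lemma entire_m_add: assumes "entire_m f" "entire_m g" shows "entire_m (\<lambda>z. f z + g z)"
  unfolding entire_m_def
proof
  fix z
  obtain L M where "(f has_derivative L) (at z)" "\<And>c x. L (c *s x) = c * L x"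
    "(g has_derivative M) (at z)" "\<And>c x. M (c *s x) = c * M x"
    using assms unfolding entire_m_def by metis
  then show "\<exists>L. ((\<lambda>z. f z + g z) has_derivative L) (at z) \<and> (\<forall>c x. L (c *s x) = c * L x)"
    by (intro exI[of _ "\<lambda>x. L x + M x"]) (auto intro!: derivative_intros simp: algebra_simps)
qed

lemma entire_m_mult: assumes "entire_m f" "entire_m g" shows "entire_m (\<lambda>z. f z * g z)"
  unfolding entire_m_def
proof
  fix z
  obtain L M where "(f has_derivative L) (at z)" "\<And>c x. L (c *s x) = c * L x"
    "(g has_derivative M) (at z)" "\<And>c x. M (c *s x) = c * M x"
    using assms unfolding entire_m_def by metis
  then show "\<exists>L. ((\<lambda>z. f z * g z) has_derivative L) (at z) \<and> (\<forall>c x. L (c *s x) = c * L x)"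
    by (intro exI[of _ "\<lambda>x. f z * M x + L x * g z"] conjI has_derivative_mult) (simp_all add: algebra_simps)
qed

lemma entire_m_sum: "(\<And>i. i \<in> A \<Longrightarrow> entire_m (f i)) \<Longrightarrow> entire_m (\<lambda>z. \<Sum>i\<in>A. f i z)"
  by (induction A rule: infinite_finite_induct) (auto intro: entire_m_const entire_m_add)

lemma entire_m_prod: "(\<And>i. i \<in> A \<Longrightarrow> entire_m (f i)) \<Longrightarrow> entire_m (\<lambda>z. \<Prod>i\<in>A. f i z)"
  by (induction A rule: infinite_finite_induct) (auto intro: entire_m_const entire_m_mult)

lemma entire_m_power: "entire_m f \<Longrightarrow> entire_m (\<lambda>z. f z ^ k)"
  by (induction k) (auto intro: entire_m_const entire_m_mult)

lemma entire_m_bounded_on_ball: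
  assumes "entire_m h" obtains B where "\<And>x. norm x \<le> \<rho> \<Longrightarrow> cmod (h (a + x)) \<le> B"
proof -
  have "bounded ((\<lambda>x. h (a + x)) ` cball 0 \<rho>)"
    by (intro compact_imp_bounded compact_continuous_image compact_cball
        continuous_on_compose2[OF entire_m_continuous[OF assms, of UNIV]] continuous_on_add
        continuous_on_const continuous_on_id) auto
  then obtain B where "\<And>x. x \<in> cball 0 \<rho> \<Longrightarrow> cmod (h (a + x)) \<le> B" unfolding bounded_iff by blast
  then show ?thesis by (intro that) auto
qed

lemma set_nn_integral_const_le:
  assumes "\<And>x. x \<in> A \<Longrightarrow> F x \<le> c" "A \<in> sets M"
  shows "(\<integral>\<^sup>+x\<in>A. F x \<partial>M) \<le> c * emeasure M A"
proof -
  have "(\<integral>\<^sup>+x\<in>A. F x \<partial>M) \<le> (\<integral>\<^sup>+x. c * indicator A x \<partial>M)"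
    using assms by (intro nn_integral_mono) (auto simp: indicator_def)
  then show ?thesis using assms by (simp add: nn_integral_cmult_indicator)
qed

text \<open>On each line through \<open>a\<close>, the one-variable inequality at the centre
  involves only the value \<open>h a\<close>, so the circle means are bounded uniformly in
  \<open>x\<close>; averaging over circles gives local integrability.\<close>

lemma ball_lnplus_inverse_finite_centred:
  assumes h: "entire_m h" and a: "h a \<noteq> 0"
  shows "(\<integral>\<^sup>+x\<in>ball 0 \<rho>. lnplus (inverse (ennreal (cmod (h (a + x))))) \<partial>lborel) < \<infinity>" (is "?I < _")
proof -
  note [measurable] = entire_m_measurable[OF h]
  obtain B where B: "\<And>x. norm x \<le> \<rho> \<Longrightarrow> cmod (h (a + x)) \<le> B"
    using entire_m_bounded_on_ball[OF h] by blast
  define Q where "Q = 9 * (lnplus (ennreal B) * emeasure lborel {0..2*pi}) + ennreal (6 * pi) * lnplus (inverse (ennreal (cmod (h a))))"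
  have Q: "Q < \<infinity>" using lnplus_const_finite[of B] a
    by (auto simp: Q_def ennreal_mult_less_top lnplus_inverse)
  have "(\<integral>\<^sup>+t\<in>{0..2*pi}. lnplus (inverse (ennreal (cmod (h (a + cis t *s x))))) \<partial>lborel) \<le> Q"
    if x: "x \<in> ball 0 \<rho>" for x
  proof -
    have "(\<integral>\<^sup>+t\<in>{0..2*pi}. lnplus (ennreal (cmod (h (a + cis t *s x)))) \<partial>lborel) \<le> lnplus (ennreal B) * emeasure lborel {0..2*pi}"
      using x by (intro set_nn_integral_const_le lnplus_mono ennreal_leI B) (auto simp: norm_vector_scalar_mult)
    then show ?thesis unfolding Q_def
      using poisson_jensen_minus[OF entire_m_line[OF h], of 0 a x]
      by (auto elim!: order.trans intro!: add_right_mono mult_left_mono)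
  qed
  then have "(\<integral>\<^sup>+x\<in>ball 0 \<rho>. (\<integral>\<^sup>+t\<in>{0..2*pi}. lnplus (inverse (ennreal (cmod (h (a + cis t *s x))))) \<partial>lborel) \<partial>lborel)
     \<le> Q * emeasure lborel (ball (0::complex^'a) \<rho>)"
    by (rule set_nn_integral_const_le) auto
  also have "\<dots> < \<infinity>" using Q emeasure_lborel_ball_finite[of "0::complex^'a" \<rho>] by (simp add: ennreal_mult_less_top)
  finally have "ennreal (2 * pi) * ?I < \<infinity>"
    by (subst nn_integral_ball_circle_average) auto
  then show ?thesis by (auto simp: ennreal_mult_less_top)
qed

lemma ball_lnplus_inverse_finite:
  assumes h: "entire_m h" and a: "h a \<noteq> 0"
  shows "(\<integral>\<^sup>+x\<in>ball 0 \<rho>. lnplus (inverse (ennreal (cmod (h x)))) \<partial>lborel) < \<infinity>"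
proof -
  note [measurable] = entire_m_measurable[OF h]
  have "(\<integral>\<^sup>+x\<in>ball 0 \<rho>. lnplus (inverse (ennreal (cmod (h x)))) \<partial>lborel) =
    (\<integral>\<^sup>+x. lnplus (inverse (ennreal (cmod (h (a + x))))) * indicator (ball 0 \<rho>) (a + x) \<partial>lborel)"
    by (subst nn_integral_lborel_shift) auto
  also have "\<dots> \<le> (\<integral>\<^sup>+x\<in>ball 0 (\<rho> + norm a). lnplus (inverse (ennreal (cmod (h (a + x))))) \<partial>lborel)"
  proof (intro nn_integral_mono mult_left_mono)
    fix x
    have "norm x < \<rho> + norm a" if "norm (a + x) < \<rho>"
      using that norm_triangle_ineq4[of "a + x" a] by simp
    then show "indicator (ball 0 \<rho>) (a + x) \<le> (indicator (ball 0 (\<rho> + norm a)) x :: ennreal)"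
      by (auto simp: indicator_def)
  qed simp
  also have "\<dots> < \<infinity>" by (rule ball_lnplus_inverse_finite_centred[OF assms])
  finally show ?thesis .
qed

text \<open>At the zeros of \<open>h\<close> the function log^+ of \<open>1 / |h|\<close> is
  infinite, but it is integrable over the ball.\<close>

lemma entire_m_AE_nonzero:
  assumes h: "entire_m h" and a: "h a \<noteq> 0"
  shows "AE x in lborel. x \<in> ball 0 1 \<longrightarrow> h x \<noteq> 0"
proof -
  note [measurable] = entire_m_measurable[OF h]
  have "AE x in lborel. lnplus (inverse (ennreal (cmod (h x)))) * indicator (ball 0 1) x \<noteq> \<infinity>"
    using ball_lnplus_inverse_finite[OF assms, of 1] by (intro nn_integral_noteq_infinite) auto
  then show ?thesis by eventually_elim (auto simp: indicator_def)
qed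

lemma AE_ball_imp_ex:
  assumes "AE x in lborel. x \<in> ball (0::'a::euclidean_space) 1 \<longrightarrow> P x"
  shows "\<exists>x\<in>ball 0 1. P x"
proof (rule ccontr)
  assume "\<not> ?thesis"
  then have "AE x in lborel. x \<notin> ball (0::'a) 1" using assms by (auto elim!: eventually_mono)
  then have "ball (0::'a) 1 \<in> null_sets lborel" by (subst AE_iff_null_sets) auto
  then show False using emeasure_unit_ball(1)[where 'a='a] by (simp only: null_setsD1)
qed

text \<open>The zero sets of the factors are null in the ball and cannot cover it. This makes the
  coefficient ring an integral domain.\<close>

lemma entire_m_mult_nonzero:
  assumes "entire_m f" "entire_m g" "f \<noteq> (\<lambda>z. 0)" "g \<noteq> (\<lambda>z. 0)"
  shows "(\<lambda>z. f z * g z) \<noteq> (\<lambda>z. 0)"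
proof -
  obtain a where "f a \<noteq> 0" using assms(3) by (meson ext)
  moreover obtain b where "g b \<noteq> 0" using assms(4) by (meson ext)
  ultimately have "AE x in lborel. x \<in> ball 0 1 \<longrightarrow> f x \<noteq> 0" "AE x in lborel. x \<in> ball 0 1 \<longrightarrow> g x \<noteq> 0"
    using assms(1,2) by (blast intro: entire_m_AE_nonzero)+
  then have "AE x in lborel. x \<in> ball 0 1 \<longrightarrow> f x * g x \<noteq> 0"
    by eventually_elim simp
  from AE_ball_imp_ex[OF this] show ?thesis by metis
qed

section \<open>Proximity functions and growth\<close>

lemma borel_measurable_sphere_proj [measurable]:
  "(\<lambda>x. (r / norm x) *\<^sub>R x) \<in> borel_measurable (borel :: 'a::euclidean_space measure)"
  by measurable

lemma sphere_proj_rotate: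
  fixes x :: "complex^'m"
  shows "(r / norm (cis t *s x)) *\<^sub>R (cis t *s x) = cis t *s ((r / norm x) *\<^sub>R x)"
  by (simp add: norm_vector_scalar_mult scaleR_eq_vector_scalar_mult vector_smult_assoc mult.commute)

lemma divide_unit_ball_finite_iff:
  "x / emeasure lborel (ball (0::'a::euclidean_space) 1) < \<infinity> \<longleftrightarrow> x < \<infinity>"
  using emeasure_unit_ball[where 'a='a] by (auto simp: less_top[symmetric] ennreal_divide_eq_top_iff)

lemma prox_nn_circle_average:
  fixes \<phi> :: "complex^'m \<Rightarrow> ennreal"
  assumes [measurable]: "\<phi> \<in> borel_measurable borel"
  shows "ennreal (2 * pi) * (\<integral>\<^sup>+x\<in>ball 0 1. lnplus (\<phi> ((r / norm x) *\<^sub>R x)) \<partial>lborel) =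
    (\<integral>\<^sup>+x\<in>ball 0 1. (\<integral>\<^sup>+t\<in>{0..2*pi}. lnplus (\<phi> (cis t *s ((r / norm x) *\<^sub>R x))) \<partial>lborel) \<partial>lborel)"
  using nn_integral_ball_circle_average[of "\<lambda>x. lnplus (\<phi> ((r / norm x) *\<^sub>R x))" 1]
  by (simp only: sphere_proj_rotate) measurable

text \<open>The one-variable inequality is applied on the line through \<open>x\<close>, at the point \<open>x\<close> instead of the centre \<open>0\<close>;
  averaging over \<open>x\<close> in the unit ball then also covers the case \<open>h 0 = 0\<close>.  Note that \<open>inverse 0 = \<infinity>\<close> for
  extended reals, unlike in the definition of the defect.\<close>
lemma prox_nn_inverse_le:
  fixes h :: "complex^'m \<Rightarrow> complex"
  assumes h: "entire_m h" and a: "h a \<noteq> 0"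
  obtains C where "C < \<infinity>"
    "\<And>r. 2 \<le> r \<Longrightarrow> prox_nn r (\<lambda>z. inverse (ennreal (cmod (h z)))) \<le> 9 * prox_nn r (\<lambda>z. ennreal (cmod (h z))) + C"
proof
  note [measurable] = entire_m_measurable[OF h]
  let ?B = "ball (0::complex^'m) 1"
  define D where "D = (\<integral>\<^sup>+x\<in>?B. lnplus (inverse (ennreal (cmod (h x)))) \<partial>lborel)"
  have D: "D < \<infinity>" unfolding D_def by (rule ball_lnplus_inverse_finite[OF assms])
  show "3 * D / emeasure lborel ?B < \<infinity>"
    using D by (simp only: divide_unit_ball_finite_iff) (simp add: ennreal_mult_less_top)
  fix r :: real assume r: "2 \<le> r"
  define P where "P = (\<integral>\<^sup>+x\<in>?B. lnplus (ennreal (cmod (h ((r / norm x) *\<^sub>R x)))) \<partial>lborel)"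
  define M where "M = (\<integral>\<^sup>+x\<in>?B. lnplus (inverse (ennreal (cmod (h ((r / norm x) *\<^sub>R x))))) \<partial>lborel)"
  let ?p = "\<lambda>x. \<integral>\<^sup>+t\<in>{0..2*pi}. lnplus (ennreal (cmod (h (cis t *s ((r / norm x) *\<^sub>R x))))) \<partial>lborel"
  let ?m = "\<lambda>x. \<integral>\<^sup>+t\<in>{0..2*pi}. lnplus (inverse (ennreal (cmod (h (cis t *s ((r / norm x) *\<^sub>R x)))))) \<partial>lborel"
  have [measurable]: "cis \<in> borel_measurable borel"
    by (intro borel_measurable_continuous_onI continuous_intros)
  have "?m x \<le> 9 * ?p x + ennreal (6 * pi) * lnplus (inverse (ennreal (cmod (h x))))" if x: "x \<in> ?B" for x
  proof -
    \<comment> \<open>\<open>x\<close> has parameter \<open>norm x / r\<close> on the line through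
      its projection to the sphere; \<open>r \<ge> 2\<close> keeps this parameter within 1/2, where
      the kernel bounds hold.\<close>
    have b: "cmod (of_real (norm x / r)) \<le> 1/2" using r x by (simp add: field_simps del: of_real_divide)
    have "of_real (norm x / r) *s ((r / norm x) *\<^sub>R x) = x" using r
      by (cases "x = 0") (auto simp: scaleR_eq_vector_scalar_mult vector_smult_assoc simp flip: of_real_mult of_real_divide)
    then show ?thesis
      using poisson_jensen_minus[OF entire_m_line0[OF h] b, of "(r / norm x) *\<^sub>R x"] by simp
  qed
  then have "(\<integral>\<^sup>+x\<in>?B. ?m x \<partial>lborel) \<le> (\<integral>\<^sup>+x. 9 * (?p x * indicator ?B x) +
      ennreal (6 * pi) * (lnplus (inverse (ennreal (cmod (h x)))) * indicator ?B x) \<partial>lborel)"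
    by (intro nn_integral_mono) (auto simp: indicator_def)
  also have "\<dots> = 9 * (\<integral>\<^sup>+x\<in>?B. ?p x \<partial>lborel) + ennreal (6 * pi) * D"
    by (subst nn_integral_add) (simp_all add: nn_integral_cmult D_def)
  finally have "ennreal (2 * pi) * M \<le> 9 * (ennreal (2 * pi) * P) + ennreal (6 * pi) * D"
    unfolding P_def M_def by (subst (1 2) prox_nn_circle_average) simp_all
  also have "ennreal (6 * pi) = ennreal (2 * pi) * 3"
    by (simp add: ennreal_mult' mult_ac)
  also have "9 * (ennreal (2 * pi) * P) + ennreal (2 * pi) * 3 * D = ennreal (2 * pi) * (9 * P + 3 * D)"
    by (simp add: distrib_left mult_ac)
  finally have "M \<le> 9 * P + 3 * D"
    by (subst (asm) ennreal_mult_le_mult_iff) auto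
  then have "M / emeasure lborel ?B \<le> (9 * P + 3 * D) / emeasure lborel ?B"
    by (rule divide_right_mono_ennreal)
  then show "prox_nn r (\<lambda>z. inverse (ennreal (cmod (h z)))) \<le> 9 * prox_nn r (\<lambda>z. ennreal (cmod (h z))) + 3 * D / emeasure lborel ?B"
    unfolding prox_nn_def P_def[symmetric] M_def[symmetric]
    by (simp add: divide_ennreal_def distrib_right mult.assoc)
qed

lemma prox_nn_finite:
  fixes h :: "complex^'m \<Rightarrow> complex"
  assumes "entire_m h" shows "prox_nn r (\<lambda>z. ennreal (cmod (h z))) < \<infinity>"
proof -
  let ?B = "ball (0::complex^'m) 1"
  obtain B where B: "\<And>x. norm x \<le> \<bar>r\<bar> \<Longrightarrow> cmod (h (0 + x)) \<le> B"
    using entire_m_bounded_on_ball[OF assms, where a=0] by blast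
  have "(\<integral>\<^sup>+x\<in>?B. lnplus (ennreal (cmod (h ((r / norm x) *\<^sub>R x)))) \<partial>lborel) \<le> lnplus (ennreal B) * emeasure lborel ?B"
  proof (rule set_nn_integral_const_le)
    fix x :: "complex^'m"
    have "norm ((r / norm x) *\<^sub>R x) \<le> \<bar>r\<bar>" by (cases "x = 0") auto
    from B[OF this] show "lnplus (ennreal (cmod (h ((r / norm x) *\<^sub>R x)))) \<le> lnplus (ennreal B)"
      by (intro lnplus_mono ennreal_leI) simp
  qed simp
  also have "\<dots> < \<infinity>" using lnplus_const_finite[of B] emeasure_lborel_ball_finite[of "0::complex^'m" 1]
    by (simp add: ennreal_mult_less_top)
  finally show ?thesis unfolding prox_nn_def divide_unit_ball_finite_iff .
qed

lemma prox_nn_inverse_finite: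
  fixes h :: "complex^'m \<Rightarrow> complex"
  assumes "entire_m h" "h a \<noteq> 0" "2 \<le> r"
  shows "prox_nn r (\<lambda>z. inverse (ennreal (cmod (h z)))) < \<infinity>"
proof -
  obtain C where "C < \<infinity>" "prox_nn r (\<lambda>z. inverse (ennreal (cmod (h z)))) \<le> 9 * prox_nn r (\<lambda>z. ennreal (cmod (h z))) + C"
    using prox_nn_inverse_le[OF assms(1,2)] assms(3) by metis
  moreover have "9 * prox_nn r (\<lambda>z. ennreal (cmod (h z))) + C < \<infinity>"
    using prox_nn_finite[OF assms(1), of r] \<open>C < \<infinity>\<close> by (simp add: ennreal_mult_less_top)
  ultimately show ?thesis by (rule_tac order.strict_trans1)
qed

text \<open>A finite mean of log^+ of \<open>1 / |h|\<close> leaves only a null set of directions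
  for zeros. This is for estimates that divide by \<open>f 0\<close> and may fail at its zeros,
  where the quotient is 0 by convention.\<close>

lemma entire_m_AE_nonzero_sphere:
  fixes h :: "complex^'m \<Rightarrow> complex"
  assumes h: "entire_m h" and "h a \<noteq> 0" "2 \<le> r"
  shows "AE x in lborel. x \<in> ball 0 1 \<longrightarrow> h ((r / norm x) *\<^sub>R x) \<noteq> 0"
proof -
  note [measurable] = entire_m_measurable[OF h]
  have "(\<integral>\<^sup>+x\<in>ball 0 1. lnplus (inverse (ennreal (cmod (h ((r / norm x) *\<^sub>R x))))) \<partial>lborel) < \<infinity>"
    using prox_nn_inverse_finite[OF assms] unfolding prox_nn_def divide_unit_ball_finite_iff .
  then have "AE x in lborel. lnplus (inverse (ennreal (cmod (h ((r / norm x) *\<^sub>R x))))) * indicator (ball 0 1) x \<noteq> \<infinity>"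
    by (intro nn_integral_noteq_infinite) auto
  then show ?thesis by eventually_elim (auto simp: indicator_def)
qed

text \<open>A bound on log^+ is a bound on \<open>h\<close> along the line, so Liouville's theorem
  applies.\<close>

lemma entire_line_constant:
  assumes h: "entire_m h" and fin: "Q < \<infinity>"
    and le: "\<And>\<tau>. ennreal (2 * pi) * lnplus (ennreal (cmod (h (\<tau> *s u)))) \<le> Q"
  shows "h (\<tau> *s u) = h 0"
proof -
  obtain q where q: "Q = ennreal q" "0 \<le> q" using fin by (cases Q rule: ennreal_cases) auto
  have "cmod (h (\<tau> *s u)) \<le> exp q" for \<tau>
  proof (cases "cmod (h (\<tau> *s u)) \<le> 1")
    case True then show ?thesis using q(2) by (meson order.trans one_le_exp_iff)
  next
    case False
    have "ennreal (2 * pi * max 0 (ln (cmod (h (\<tau> *s u))))) \<le> ennreal q"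
      using le[of \<tau>] by (simp only: lnplus_ennreal[OF norm_ge_zero] q ennreal_mult[symmetric] mult_nonneg_nonneg pi_ge_zero max.cobounded1)
    then have "2 * pi * max 0 (ln (cmod (h (\<tau> *s u)))) \<le> q" using q by simp
    moreover have "1 * ln (cmod (h (\<tau> *s u))) \<le> 2 * pi * max 0 (ln (cmod (h (\<tau> *s u))))"
      using False pi_gt3 by (intro mult_mono) auto
    ultimately have "ln (cmod (h (\<tau> *s u))) \<le> q" by simp
    then show ?thesis using False ln_le_cancel_iff[of "cmod (h (\<tau> *s u))" "exp q"] by (cases "h (\<tau> *s u) = 0") auto
  qed
  then have "bounded (range (\<lambda>\<tau>. h (\<tau> *s u)))" by (auto simp: bounded_iff)
  from Liouville_theorem[OF entire_m_line0[OF h] this] obtain c where "\<And>\<tau>. h (\<tau> *s u) = c"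
    by (auto simp: constant_on_def)
  from this[of \<tau>] this[of 0] show ?thesis by simp
qed

text \<open>If the characteristic stays bounded along a sequence of radii, then by Fatou the circle means are
  bounded along a subsequence on almost every complex line through the origin, so \<open>h\<close> is constant on it.\<close>
lemma filterlim_prox_at_top:
  fixes h :: "complex^'m \<Rightarrow> complex"
  assumes h: "entire_m h" and nc: "nonconstant h"
  shows "filterlim (\<lambda>r. prox r h) at_top at_top"
proof (rule ccontr)
  note [measurable] = entire_m_measurable[OF h]
  let ?B = "ball (0::complex^'m) 1"
  let ?V = "emeasure lborel ?B"
  assume "\<not> ?thesis"
  then obtain Z where Z: "\<exists>\<^sub>F r in at_top. \<not> Z \<le> prox r h"
    unfolding filterlim_at_top frequently_def by auto
  have "\<exists>r. real k + 1 \<le> r \<and> prox r h \<le> Z" for k :: nat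
    using frequently_eventually_frequently[OF Z eventually_ge_at_top[of "real k + 1"]]
    by (auto dest!: frequently_ex)
  then obtain r where r: "\<And>k. real k + 1 \<le> r k" "\<And>k. prox (r k) h \<le> Z" by metis
  define \<phi> where "\<phi> k x = (\<integral>\<^sup>+t\<in>{0..2*pi}. lnplus (ennreal (cmod (h (cis t *s ((r k / norm x) *\<^sub>R x))))) \<partial>lborel)" for k x
  have [measurable]: "cis \<in> borel_measurable borel"
    by (intro borel_measurable_continuous_onI continuous_intros)
  have [measurable]: "\<phi> k \<in> borel_measurable borel" for k unfolding \<phi>_def by measurable
  have bd: "(\<integral>\<^sup>+x\<in>?B. \<phi> k x \<partial>lborel) \<le> ennreal (2 * pi) * (ennreal Z * ?V)" for k
  proof -
    have "prox_nn (r k) (\<lambda>z. ennreal (cmod (h z))) = ennreal (prox (r k) h)"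
      using prox_nn_finite[OF h, of "r k"] by (simp add: prox_def)
    also have "\<dots> \<le> ennreal Z" using r by (intro ennreal_leI)
    finally have "prox_nn (r k) (\<lambda>z. ennreal (cmod (h z))) * ?V \<le> ennreal Z * ?V"
      by (rule mult_right_mono) simp
    then have "(\<integral>\<^sup>+x\<in>?B. lnplus (ennreal (cmod (h ((r k / norm x) *\<^sub>R x)))) \<partial>lborel) \<le> ennreal Z * ?V"
      unfolding prox_nn_def using emeasure_unit_ball[where 'a="complex^'m"]
      by (simp add: ennreal_divide_times less_top)
    then show ?thesis unfolding \<phi>_def
      by (subst prox_nn_circle_average[symmetric]) (auto intro!: mult_left_mono)
  qed
  have "(\<integral>\<^sup>+x. liminf (\<lambda>k. \<phi> k x * indicator ?B x) \<partial>lborel) \<le> liminf (\<lambda>k. \<integral>\<^sup>+x\<in>?B. \<phi> k x \<partial>lborel)"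
    by (rule nn_integral_liminf) simp
  also have "\<dots> \<le> liminf (\<lambda>k. ennreal (2 * pi) * (ennreal Z * ?V))"
    by (intro Liminf_mono always_eventually allI bd)
  also have "\<dots> < \<infinity>" using emeasure_unit_ball[where 'a="complex^'m"]
    by (simp add: Liminf_const ennreal_mult_less_top less_top)
  finally have "AE x in lborel. liminf (\<lambda>k. \<phi> k x * indicator ?B x) \<noteq> \<infinity>"
    by (intro nn_integral_noteq_infinite) auto
  then have AE: "AE x in lborel. x \<in> ?B \<longrightarrow> (\<forall>\<tau>. h (\<tau> *s x) = h 0)"
  proof eventually_elim
    case (elim x)
    show ?case
    proof
      assume x: "x \<in> ?B"
      let ?u = "(1 / norm x) *\<^sub>R x"
      have "ennreal (2 * pi) * lnplus (ennreal (cmod (h (\<tau> *s ?u)))) \<le> 3 * liminf (\<lambda>k. \<phi> k x)" for \<tau>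
      proof -
        \<comment> \<open>For \<open>k \<ge> 2 * cmod \<tau>\<close> the parameter
          \<open>\<tau> / r k\<close> lies in the disc of radius 1/2, so the circle mean of radius
          \<open>r k\<close> controls the value at \<open>\<tau> *s ?u\<close>.\<close>
        have "\<forall>\<^sub>F k in sequentially. ennreal (2 * pi) * lnplus (ennreal (cmod (h (\<tau> *s ?u)))) \<le> 3 * \<phi> k x"
          using eventually_ge_at_top[of "nat \<lceil>2 * cmod \<tau>\<rceil>"]
        proof eventually_elim
          case (elim k)
          have "2 * cmod \<tau> \<le> r k" "0 < r k" using elim r(1)[of k] by linarith+
          then have b: "cmod (\<tau> / of_real (r k)) \<le> 1/2" by (simp add: norm_divide field_simps)
          have "(\<tau> / of_real (r k)) *s ((r k / norm x) *\<^sub>R x) = \<tau> *s ?u"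
            using \<open>0 < r k\<close> by (simp add: scaleR_eq_vector_scalar_mult vector_smult_assoc)
          then show ?case unfolding \<phi>_def
            using poisson_jensen_plus[OF entire_m_line0[OF h] b, of "(r k / norm x) *\<^sub>R x"] by simp
        qed
        then have "liminf (\<lambda>k. ennreal (2 * pi) * lnplus (ennreal (cmod (h (\<tau> *s ?u))))) \<le> liminf (\<lambda>k. 3 * \<phi> k x)"
          by (rule Liminf_mono)
        also have "\<dots> = 3 * liminf (\<lambda>k. \<phi> k x)"
          by (rule Liminf_compose_continuous_mono)
             (auto intro!: ennreal_continuous_on_cmult continuous_on_id monoI mult_left_mono)
        finally show ?thesis by (simp add: Liminf_const)
      qed
      moreover have "3 * liminf (\<lambda>k. \<phi> k x) < \<infinity>"
        using elim x by (simp add: ennreal_mult_less_top less_top)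
      ultimately have *: "h (\<tau> *s ?u) = h 0" for \<tau> by (intro entire_line_constant[OF h])
      have "\<tau> *s x = (\<tau> * of_real (norm x)) *s ?u" for \<tau>
        by (cases "x = 0") (auto simp: scaleR_eq_vector_scalar_mult vector_smult_assoc)
      with * show "\<forall>\<tau>. h (\<tau> *s x) = h 0" by metis
    qed
  qed
  have "h y = h 0" for y
  proof (rule ccontr)
    assume y: "h y \<noteq> h 0"
    define K where "K = norm y + 1"
    have K: "0 < K" unfolding K_def by (simp add: add_nonneg_pos)
    \<comment> \<open>\<open>W\<close> is open, contains \<open>y / K\<close> and is null, by the
      almost everywhere statement at \<tau> = \<open>K\<close>; this passes from almost all lines to
      every point.\<close>
    define W where "W = ?B \<inter> (\<lambda>x. h (K *\<^sub>R x)) -` (- {h 0})"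
    have "open W" unfolding W_def
      by (intro open_Int open_ball open_vimage continuous_on_compose2[OF entire_m_continuous[OF h, of UNIV]]
         continuous_intros) auto
    moreover have "(1 / K) *\<^sub>R y \<in> W" using K y by (auto simp: W_def) (simp add: K_def field_simps)
    ultimately have "\<not> negligible W" using open_not_negligible by blast
    moreover have "AE x in lborel. x \<notin> W"
      using AE by eventually_elim (auto simp: W_def scaleR_eq_vector_scalar_mult)
    then have "W \<in> null_sets lborel" using \<open>open W\<close> by (subst AE_iff_null_sets) auto
    then have "negligible W" by (simp add: negligible_iff_null_sets null_sets_completionI)
    ultimately show False by contradiction
  qed
  then show False using nc by (auto simp: nonconstant_def)
qed

section \<open>Linear systems and multi-indices\<close>

text \<open>Gaussian elimination without division, by induction on the equations, so that the
  solution stays in the subring \<open>A\<close>. Absence of zero divisors is asked of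
  \<open>A\<close> only, because the ring of all functions has them.\<close>

lemma homogeneous_system_nontrivial_solution:
  fixes A :: "'a::comm_ring_1 set"
  assumes one: "1 \<in> A" and add: "\<And>x y. x \<in> A \<Longrightarrow> y \<in> A \<Longrightarrow> x + y \<in> A"
    and mult: "\<And>x y. x \<in> A \<Longrightarrow> y \<in> A \<Longrightarrow> x * y \<in> A" and minus: "\<And>x. x \<in> A \<Longrightarrow> - x \<in> A"
    and dom: "\<And>x y. x \<in> A \<Longrightarrow> y \<in> A \<Longrightarrow> x \<noteq> 0 \<Longrightarrow> y \<noteq> 0 \<Longrightarrow> x * y \<noteq> 0"
    and "finite E" "finite U" "card E < card U" "\<And>e u. e \<in> E \<Longrightarrow> u \<in> U \<Longrightarrow> m e u \<in> A"
  shows "\<exists>x. (\<forall>u\<in>U. x u \<in> A) \<and> (\<exists>u\<in>U. x u \<noteq> 0) \<and> (\<forall>e\<in>E. (\<Sum>u\<in>U. m e u * x u) = 0)"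
  using assms(6-9)
proof (induction E arbitrary: U m rule: finite_induct)
  case empty
  then obtain u where "u \<in> U" by fastforce
  have "0 \<in> A" using add[OF one minus[OF one]] by simp
  with one \<open>u \<in> U\<close> show ?case
    by (intro exI[of _ "\<lambda>v. if v = u then 1 else 0"]) auto
next
  case (insert e E)
  have zero: "0 \<in> A" using add[OF one minus[OF one]] by simp
  have sumA: "sum g V \<in> A" if "\<And>v. v \<in> V \<Longrightarrow> g v \<in> A" for g and V :: "'c set"
    using that by (induction V rule: infinite_finite_induct) (auto intro: zero add)
  show ?case
  proof (cases "\<forall>u\<in>U. m e u = 0")
    case True
    obtain x where "\<forall>u\<in>U. x u \<in> A" "\<exists>u\<in>U. x u \<noteq> 0" "\<forall>e\<in>E. (\<Sum>u\<in>U. m e u * x u) = 0"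
      using insert.IH[of U m] insert.prems insert.hyps by auto
    with True show ?thesis by (intro exI[of _ x]) auto
  next
    case False
    then obtain v where v: "v \<in> U" "m e v \<noteq> 0" by auto
    define V where "V = U - {v}"
    have V: "finite V" "v \<notin> V" "U = insert v V" using v insert.prems by (auto simp: V_def)
    define p where "p = m e v"
    have mA: "m e' u \<in> A" if "e' \<in> insert e E" "u \<in> U" for e' u using insert.prems(3) that by blast
    \<comment> \<open>Row \<open>e'\<close> times the pivot minus \<open>m e' v\<close> times row
      \<open>e\<close>: cross multiplication eliminates the unknown \<open>v\<close>.\<close>
    define m' where "m' e' u = p * m e' u - m e' v * m e u" for e' u
    have "card E < card V" using insert.prems insert.hyps V by simp
    moreover have "m' e' u \<in> A" if "e' \<in> E" "u \<in> V" for e' u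
      unfolding m'_def p_def diff_conv_add_uminus using that V by (intro add mult minus mA) auto
    ultimately obtain y where y: "\<forall>u\<in>V. y u \<in> A" "\<exists>u\<in>V. y u \<noteq> 0" "\<And>e'. e' \<in> E \<Longrightarrow> (\<Sum>u\<in>V. m' e' u * y u) = 0"
      using insert.IH[of V m'] V(1) by metis
    \<comment> \<open>Scaling the other unknowns by the pivot lets the equation \<open>e\<close> be
      solved for \<open>x v\<close> without division.\<close>
    define x where "x u = (if u = v then - (\<Sum>u\<in>V. m e u * y u) else p * y u)" for u
    have sumx: "(\<Sum>u\<in>U. m e' u * x u) = (\<Sum>u\<in>V. m' e' u * y u)" for e'
    proof -
      have "(\<Sum>u\<in>U. m e' u * x u) = m e' v * x v + (\<Sum>u\<in>V. m e' u * x u)"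
        using V by simp
      also have "(\<Sum>u\<in>V. m e' u * x u) = (\<Sum>u\<in>V. m e' u * (p * y u))"
        using V by (intro sum.cong) (auto simp: x_def)
      also have "m e' v * x v = (\<Sum>u\<in>V. - (m e' v * (m e u * y u)))"
        by (simp add: x_def sum_distrib_left sum_negf)
      finally show ?thesis by (simp add: sum.distrib[symmetric] m'_def algebra_simps)
    qed
    have "(\<Sum>u\<in>U. m e u * x u) = 0" unfolding sumx m'_def p_def by (simp add: mult.commute)
    moreover have "x u \<in> A" if "u \<in> U" for u
      unfolding x_def p_def using that y V by (auto intro!: minus sumA mult mA)
    moreover have "\<exists>u\<in>U. x u \<noteq> 0"
    proof -
      obtain u where u: "u \<in> V" "y u \<noteq> 0" using y by auto
      then have "p * y u \<noteq> 0" using v y mA unfolding p_def by (intro dom) auto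
      with u V show ?thesis by (intro bexI[of _ u]) (auto simp: x_def)
    qed
    ultimately show ?thesis using y(3) sumx by (intro exI[of _ x]) auto
  qed
qed

section \<open>Orders and counts of multi-indices\<close>

lemma base_digits_unique:
  fixes I J :: "nat \<Rightarrow> nat"
  assumes "\<And>k. k < n \<Longrightarrow> I k < B" "\<And>k. k < n \<Longrightarrow> J k < B"
    "(\<Sum>k<n. I k * B ^ k) = (\<Sum>k<n. J k * B ^ k)" "k < n"
  shows "I k = J k"
  using assms
proof (induction n arbitrary: I J k)
  case (Suc n)
  have split: "(\<Sum>k<Suc n. X k * B ^ k) = X 0 + B * (\<Sum>k<n. X (Suc k) * B ^ k)" for X :: "nat \<Rightarrow> nat"
    by (simp only: sum.lessThan_Suc_shift) (simp add: sum_distrib_left mult_ac)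
  have "I 0 + B * (\<Sum>k<n. I (Suc k) * B ^ k) = J 0 + B * (\<Sum>k<n. J (Suc k) * B ^ k)"
    using Suc.prems(3) unfolding split .
  moreover have "I 0 < B" "J 0 < B" using Suc.prems by auto
  moreover have "(x + B * y) mod B = x" if "x < B" for x y using that by simp
  ultimately have "I 0 = J 0" by metis
  with \<open>I 0 + _ = _\<close> \<open>I 0 < B\<close> have "(\<Sum>k<n. I (Suc k) * B ^ k) = (\<Sum>k<n. J (Suc k) * B ^ k)"
    by simp
  note this \<open>I 0 = J 0\<close>
  with Suc.IH[of "\<lambda>k. I (Suc k)" "\<lambda>k. J (Suc k)" "k - 1"] Suc.prems
  show ?case by (cases k) auto
qed simp

lemma multi_idx_eqI:
  assumes "I \<in> multi_idx n" "J \<in> multi_idx n" "\<And>k. k < n \<Longrightarrow> I k = J k" shows "I = J"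
proof
  show "I k = J k" for k using assms by (cases "k < n") (auto simp: multi_idx_def)
qed

lemma mdeg_add: "mdeg n (I + J) = mdeg n I + mdeg n J"
  by (simp add: mdeg_def sum.distrib plus_fun_def)

lemma component_le_mdeg: "k < n \<Longrightarrow> I k \<le> mdeg n I"
  unfolding mdeg_def by (rule member_le_sum) auto

text \<open>\<open>s\<close> and \<open>t\<close> are the smallest elements for an additive total order that refines the total degree.\<close>
lemma ex_uniquely_represented_sum:
  assumes "S \<subseteq> multi_idx n" "T \<subseteq> multi_idx n" "S \<noteq> {}" "T \<noteq> {}"
  shows "\<exists>s\<in>S. \<exists>t\<in>T. (\<forall>t'\<in>T. mdeg n t \<le> mdeg n t') \<and> (\<forall>s'\<in>S. \<forall>t'\<in>T. s' + t' = s + t \<longrightarrow> s' = s \<and> t' = t)"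
proof -
  obtain s0 where s0: "s0 \<in> S" "\<And>s. s \<in> S \<Longrightarrow> mdeg n s0 \<le> mdeg n s"
    using ex_has_least_nat[of "\<lambda>s. s \<in> S" _ "mdeg n"] assms(3) by blast
  obtain t0 where t0: "t0 \<in> T" "\<And>t. t \<in> T \<Longrightarrow> mdeg n t0 \<le> mdeg n t"
    using ex_has_least_nat[of "\<lambda>t. t \<in> T" _ "mdeg n"] assms(4) by blast
  \<comment> \<open>\<open>B\<close> exceeds all components of indices of the two minimal degrees,
    so \<open>W\<close> reads these indices as digits in base \<open>B\<close>: it is additive, and
    injective on them.\<close>
  define B where "B = mdeg n s0 + mdeg n t0 + 1"
  define W where "W I = (\<Sum>k<n. I k * B ^ k)" for I :: "nat \<Rightarrow> nat"
  have Wadd: "W (I + J) = W I + W J" for I J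
    by (simp add: W_def plus_fun_def sum.distrib algebra_simps)
  obtain s where s: "s \<in> S" "mdeg n s = mdeg n s0" "\<And>s'. s' \<in> S \<Longrightarrow> mdeg n s' = mdeg n s0 \<Longrightarrow> W s \<le> W s'"
    using ex_has_least_nat[of "\<lambda>s. s \<in> S \<and> mdeg n s = mdeg n s0" _ W] s0(1) by blast
  obtain t where t: "t \<in> T" "mdeg n t = mdeg n t0" "\<And>t'. t' \<in> T \<Longrightarrow> mdeg n t' = mdeg n t0 \<Longrightarrow> W t \<le> W t'"
    using ex_has_least_nat[of "\<lambda>t. t \<in> T \<and> mdeg n t = mdeg n t0" _ W] t0(1) by blast
  have inj: "I = J" if "I \<in> multi_idx n" "J \<in> multi_idx n" "W I = W J" "mdeg n I < B" "mdeg n J < B" for I J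
    using that(1,2)
  proof (rule multi_idx_eqI)
    show "I k = J k" if "k < n" for k
      using \<open>W I = W J\<close> \<open>mdeg n I < B\<close> \<open>mdeg n J < B\<close> \<open>k < n\<close> unfolding W_def
      by (intro base_digits_unique[of n I B J k]) (auto intro: le_less_trans[OF component_le_mdeg])
  qed
  have "s' = s \<and> t' = t" if "s' \<in> S" "t' \<in> T" "s' + t' = s + t" for s' t'
  proof -
    have "mdeg n s' + mdeg n t' = mdeg n s + mdeg n t" using that(3) by (metis mdeg_add)
    with s0(2)[OF that(1)] t0(2)[OF that(2)] s t have deg: "mdeg n s' = mdeg n s0" "mdeg n t' = mdeg n t0" by linarith+
    have "W s' + W t' = W s + W t" using that(3) by (metis Wadd)
    with s(3)[OF that(1) deg(1)] t(3)[OF that(2) deg(2)] have W: "W s' = W s" "W t' = W t" by linarith+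
    have "s' = s" by (rule inj) (use that s deg W assms in \<open>auto simp: B_def\<close>)
    moreover have "t' = t" by (rule inj) (use that t deg W assms in \<open>auto simp: B_def\<close>)
    ultimately show ?thesis by simp
  qed
  then show ?thesis using s(1) t(1) t(2) t0(2) by (intro bexI[of _ s] bexI[of _ t]) auto
qed

lemma card_multi_idx_box:
  "finite {I \<in> multi_idx n. \<forall>k<n. I k < B}" "card {I \<in> multi_idx n. \<forall>k<n. I k < B} = B ^ n"
proof -
  let ?X = "{I \<in> multi_idx n. \<forall>k<n. I k < B}" and ?Y = "{..<n} \<rightarrow>\<^sub>E {..<B}"
  have bij: "bij_betw (\<lambda>I. restrict I {..<n}) ?X ?Y"
  proof (rule bij_betw_byWitness[where f' = "\<lambda>g k. if k < n then g k else 0"])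
    show "\<forall>I\<in>?X. (\<lambda>k. if k < n then restrict I {..<n} k else 0) = I"
      by (auto simp: multi_idx_def fun_eq_iff)
    show "\<forall>g\<in>?Y. restrict (\<lambda>k. if k < n then g k else 0) {..<n} = g"
      by (auto simp: fun_eq_iff PiE_def extensional_def)
    show "(\<lambda>I. restrict I {..<n}) ` ?X \<subseteq> ?Y" by (intro image_subsetI) (simp add: restrict_PiE_iff)
    show "(\<lambda>g k. if k < n then g k else 0) ` ?Y \<subseteq> ?X" by (auto simp: multi_idx_def PiE_def Pi_def)
  qed
  have "finite ?Y" by (intro finite_PiE) auto
  then show "finite ?X" using bij_betw_finite[OF bij] by simp
  show "card ?X = B ^ n" using bij_betw_same_card[OF bij] by (simp add: card_PiE)
qed

lemma finite_multi_idx_less: "finite {I \<in> multi_idx n. mdeg n I < d}"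
  by (rule finite_subset[OF _ card_multi_idx_box(1)[of n d]])
    (auto intro: le_less_trans[OF component_le_mdeg])

lemma finite_multi_idx_eq: "finite {I \<in> multi_idx n. mdeg n I = d}"
  by (rule finite_subset[OF _ finite_multi_idx_less[of n "Suc d"]]) auto

text \<open>The last component is determined by the other ones and the degree.\<close>

lemma card_multi_idx_eq_le:
  assumes "n \<ge> 1" shows "card {I \<in> multi_idx n. mdeg n I = d} \<le> (d + 1) ^ (n - 1)"
proof -
  obtain l where n: "n = Suc l" using assms by (cases n) auto
  let ?X = "{I \<in> multi_idx n. mdeg n I = d}"
  have "inj_on (\<lambda>I. I(l := 0)) ?X"
  proof (rule inj_onI)
    fix I J assume I: "I \<in> ?X" and J: "J \<in> ?X" and eq: "I(l := 0) = J(l := 0)"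
    have e: "I k = J k" if "k \<noteq> l" for k using fun_cong[OF eq, of k] that by simp
    have "(\<Sum>k<l. I k) = (\<Sum>k<l. J k)" using e by (intro sum.cong) auto
    then have "I l = J l" using I J by (auto simp: mdeg_def n)
    with e show "I = J" by (intro ext) metis
  qed
  moreover have "(\<lambda>I. I(l := 0)) ` ?X \<subseteq> {I \<in> multi_idx l. \<forall>k<l. I k < d + 1}"
    using component_le_mdeg[of _ n] by (auto simp: multi_idx_def n less_Suc_eq_le)
  ultimately have "card ?X \<le> card {I \<in> multi_idx l. \<forall>k<l. I k < d + 1}"
    using card_multi_idx_box(1) by (rule card_inj_on_le)
  then show ?thesis by (simp add: card_multi_idx_box n)
qed

text \<open>With \<open>N = \<kappa> * x\<close>, the claim amounts to this: the indices in the top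
  \<open>p\<close> degrees below \<open>N\<close> are fewer than those of degree below
  \<open>x\<close>. The former number at most \<open>p * N ^ (n - 1)\<close>, one power of
  \<open>x\<close> short of the latter, which contain a box of side \<open>x / n\<close>.\<close>

lemma ex_degree_gap:
  assumes n: "n \<ge> 1" and "\<kappa> \<ge> 1"
  shows "\<exists>x\<ge>1. card {J \<in> multi_idx n. x \<le> mdeg n J \<and> mdeg n J < \<kappa> * x}
             < card {K \<in> multi_idx n. mdeg n K < \<kappa> * x - p}"
proof -
  \<comment> \<open>\<open>x = n * y\<close> makes the box of side \<open>y\<close> fit below degree
    \<open>x\<close>, and \<open>N = \<kappa> * n * y\<close> reduces the inequality to
    \<open>p * (\<kappa> * n) ^ (n - 1) < y\<close>.\<close>
  define y where "y = p * (\<kappa> * n) ^ (n - 1) + 1"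
  define x where "x = n * y"
  define N where "N = \<kappa> * x"
  let ?L = "\<lambda>d. {I \<in> multi_idx n. mdeg n I < d}"
  have "{I \<in> multi_idx n. \<forall>k<n. I k < y} \<subseteq> ?L x"
  proof safe
    fix I assume "\<forall>k<n. I k < y"
    then have "sum I {..<n} < of_nat (card {..<n}) * y" using n by (intro sum_bounded_above_strict) auto
    then show "mdeg n I < x" by (simp add: mdeg_def x_def)
  qed
  then have "card {I \<in> multi_idx n. \<forall>k<n. I k < y} \<le> card (?L x)"
    by (rule card_mono[OF finite_multi_idx_less])
  then have low: "y ^ n \<le> card (?L x)" unfolding card_multi_idx_box(2) .
  have Np: "N - (N - p) \<le> p" by arith
  have "?L N \<subseteq> ?L (N - p) \<union> (\<Union>d\<in>{N - p..<N}. {I \<in> multi_idx n. mdeg n I = d})" by auto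
  then have "card (?L N) \<le> card (?L (N - p) \<union> (\<Union>d\<in>{N - p..<N}. {I \<in> multi_idx n. mdeg n I = d}))"
    by (intro card_mono finite_UnI finite_UN_I finite_multi_idx_less finite_multi_idx_eq) auto
  also have "\<dots> \<le> card (?L (N - p)) + card (\<Union>d\<in>{N - p..<N}. {I \<in> multi_idx n. mdeg n I = d})"
    by (rule card_Un_le)
  also have "card (\<Union>d\<in>{N - p..<N}. {I \<in> multi_idx n. mdeg n I = d}) \<le> (\<Sum>d\<in>{N - p..<N}. card {I \<in> multi_idx n. mdeg n I = d})"
    by (rule card_UN_le) simp
  also have "\<dots> \<le> (\<Sum>d\<in>{N - p..<N}. N ^ (n - 1))"
    by (intro sum_mono order.trans[OF card_multi_idx_eq_le[OF n]] power_mono) auto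
  also have "\<dots> \<le> p * N ^ (n - 1)" using mult_le_mono1[OF Np, of "N ^ (n - 1)"] by simp
  also have "\<dots> = (p * (\<kappa> * n) ^ (n - 1)) * y ^ (n - 1)"
    by (simp add: N_def x_def power_mult_distrib mult_ac)
  also have "\<dots> < y * y ^ (n - 1)" by (intro mult_strict_right_mono) (auto simp: y_def)
  also have "y * y ^ (n - 1) = y ^ n" using n by (cases n) auto
  also note low
  finally have lt: "card (?L N) < card (?L (N - p)) + card (?L x)" by simp
  have "x \<le> N" using \<open>\<kappa> \<ge> 1\<close> by (simp add: N_def)
  then have "card (?L N - ?L x) = card (?L N) - card (?L x)"
    by (intro card_Diff_subset finite_multi_idx_less) auto
  moreover have "{J \<in> multi_idx n. x \<le> mdeg n J \<and> mdeg n J < N} = ?L N - ?L x" by auto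
  moreover have "card (?L x) \<le> card (?L N)" using \<open>x \<le> N\<close> by (intro card_mono finite_multi_idx_less) auto
  ultimately have "card {J \<in> multi_idx n. x \<le> mdeg n J \<and> mdeg n J < N} < card (?L (N - p))"
    using lt by simp
  moreover have "x \<ge> 1" using n by (simp add: x_def y_def)
  ultimately show ?thesis unfolding N_def by blast
qed

section \<open>The multiplier\<close>

text \<open>The coefficient of \<open>w ^ J\<close> in the product of the power series with the part
  of \<open>R\<close> of degree below \<open>L\<close>.\<close>

definition conv_coeff ::
  "nat \<Rightarrow> nat \<Rightarrow> ((nat \<Rightarrow> nat) \<Rightarrow> 'x \<Rightarrow> complex) \<Rightarrow> ((nat \<Rightarrow> nat) \<Rightarrow> 'x \<Rightarrow> complex) \<Rightarrow> (nat \<Rightarrow> nat) \<Rightarrow> 'x \<Rightarrow> complex" where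
  "conv_coeff n L R a J z =
     (\<Sum>K\<in>{K\<in>multi_idx n. mdeg n K < L \<and> K \<le> J}. R K z * a (\<lambda>k. J k - K k) z)"

lemma poly_ring_of_sum:
  assumes "\<And>i. i \<in> S \<Longrightarrow> g i \<in> poly_ring_of A"
  shows "(\<lambda>z. \<Sum>i\<in>S. g i z) \<in> poly_ring_of A"
  using assms by (induction S rule: infinite_finite_induct) (auto intro: poly_ring_of.intros)

lemma entire_m_poly_ring_of:
  assumes "g \<in> poly_ring_of A" "\<And>h. h \<in> A \<Longrightarrow> entire_m h" shows "entire_m g"
  using assms(1) by induction (auto intro: assms(2) entire_m_const entire_m_add entire_m_mult)

lemma sum_fun_apply: "(\<Sum>i\<in>S. g i) z = (\<Sum>i\<in>S. g i z)"
  by (induction S rule: infinite_finite_induct) auto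

lemma multi_idx_diff: "J \<in> multi_idx n \<Longrightarrow> (\<lambda>k. J k - K k) \<in> multi_idx n"
  by (auto simp: multi_idx_def)

lemma conv_coeff_in_poly_ring_of:
  assumes "\<And>K. K \<in> multi_idx n \<Longrightarrow> mdeg n K < L \<Longrightarrow> R K \<in> poly_ring_of (a ` multi_idx n)"
    and "J \<in> multi_idx n"
  shows "conv_coeff n L R a J \<in> poly_ring_of (a ` multi_idx n)"
  unfolding conv_coeff_def[abs_def] using assms(2)
  by (intro poly_ring_of_sum poly_ring_of.mult assms(1) poly_ring_of.gen imageI multi_idx_diff) auto

lemma add_diff_multi_idx: "(K :: nat \<Rightarrow> nat) \<le> J \<Longrightarrow> K + (\<lambda>k. J k - K k) = J"
  by (auto simp: fun_eq_iff le_fun_def)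

text \<open>Multiplying \<open>G\<close> by a polynomial \<open>R\<close> of degree below \<open>\<kappa> * x - p\<close>, where \<open>p\<close> is the order of \<open>G\<close> at \<open>w = 0\<close>,
  is injective modulo degree \<open>\<kappa> * x\<close>.  For large \<open>x\<close> the number of coefficients of \<open>R\<close> exceeds the number of
  monomials of degree between \<open>x\<close> and \<open>\<kappa> * x\<close>, so all these coefficients of \<open>R * G\<close> can be made to vanish.\<close>
lemma ex_multiplier_with_gap:
  fixes a :: "(nat \<Rightarrow> nat) \<Rightarrow> complex^'m \<Rightarrow> complex"
  assumes n: "n \<ge> 1" and \<kappa>: "\<kappa> \<ge> 1" and entire: "\<And>I. I \<in> multi_idx n \<Longrightarrow> entire_m (a I)"
    and nz: "\<exists>I\<in>multi_idx n. a I \<noteq> (\<lambda>z. 0)"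
  obtains x L R where "x \<ge> 1" "L \<le> \<kappa> * x"
    "\<And>K. K \<in> multi_idx n \<Longrightarrow> mdeg n K < L \<Longrightarrow> R K \<in> poly_ring_of (a ` multi_idx n)"
    "\<And>J. J \<in> multi_idx n \<Longrightarrow> x \<le> mdeg n J \<Longrightarrow> mdeg n J < \<kappa> * x \<Longrightarrow> conv_coeff n L R a J = (\<lambda>z. 0)"
    "\<exists>J\<in>multi_idx n. mdeg n J < x \<and> conv_coeff n L R a J \<noteq> (\<lambda>z. 0)"
proof -
  let ?A = "poly_ring_of (a ` multi_idx n)"
  have gen: "a I \<in> ?A" if "I \<in> multi_idx n" for I using that by (auto intro: poly_ring_of.gen)
  have entA: "entire_m g" if "g \<in> ?A" for g using that by (rule entire_m_poly_ring_of) (auto intro: entire)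
  have zeroA: "0 \<in> ?A" using poly_ring_of.const[of 0] by (simp add: zero_fun_def)
  have oneA: "1 \<in> ?A" using poly_ring_of.const[of 1] by (simp add: one_fun_def)
  have addA: "g + h \<in> ?A" if "g \<in> ?A" "h \<in> ?A" for g h
    using poly_ring_of.add[OF that] by (simp add: plus_fun_def)
  have multA: "g * h \<in> ?A" if "g \<in> ?A" "h \<in> ?A" for g h
    using poly_ring_of.mult[OF that] by (simp add: times_fun_def)
  have minusA: "- g \<in> ?A" if "g \<in> ?A" for g
    using poly_ring_of.mult[OF poly_ring_of.const[of "-1"] that] by (simp add: fun_Compl_def)
  have domA: "g * h \<noteq> 0" if "g \<in> ?A" "h \<in> ?A" "g \<noteq> 0" "h \<noteq> 0" for g h
    using entire_m_mult_nonzero[OF entA[OF that(1)] entA[OF that(2)]] that(3,4)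
    by (simp add: zero_fun_def times_fun_def)
  define T where "T = {I \<in> multi_idx n. a I \<noteq> 0}"
  have "T \<noteq> {}" using nz by (auto simp: T_def zero_fun_def)
  then obtain I1 where I1: "I1 \<in> T" "\<And>I. I \<in> T \<Longrightarrow> mdeg n I1 \<le> mdeg n I"
    using ex_has_least_nat[of "\<lambda>s. s \<in> T" _ "mdeg n"] by blast
  define p where "p = mdeg n I1"
  obtain x where x: "x \<ge> 1" "card {J \<in> multi_idx n. x \<le> mdeg n J \<and> mdeg n J < \<kappa> * x}
             < card {K \<in> multi_idx n. mdeg n K < \<kappa> * x - p}"
    using ex_degree_gap[OF n \<kappa>] by blast
  define L where "L = \<kappa> * x - p"
  define E where "E = {J \<in> multi_idx n. x \<le> mdeg n J \<and> mdeg n J < \<kappa> * x}"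
  define U where "U = {K \<in> multi_idx n. mdeg n K < L}"
  have finU: "finite U" unfolding U_def by (rule finite_multi_idx_less)
  have finE: "finite E" unfolding E_def by (rule finite_subset[OF _ finite_multi_idx_less[of n "\<kappa> * x"]]) auto
  define m where "m J K = (if K \<le> J then a (\<lambda>k. J k - K k) else 0)" for J K
  have mA: "m J K \<in> ?A" if "J \<in> E" for J K
    using that by (auto simp: m_def E_def intro!: gen multi_idx_diff zeroA)
  have "\<exists>R. (\<forall>u\<in>U. R u \<in> ?A) \<and> (\<exists>u\<in>U. R u \<noteq> 0) \<and> (\<forall>e\<in>E. (\<Sum>u\<in>U. m e u * R u) = 0)"
    by (rule homogeneous_system_nontrivial_solution[OF oneA addA multA minusA domA finE finU])
       (use x(2) mA in \<open>auto simp: E_def U_def L_def\<close>)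
  then obtain R where R: "\<And>K. K \<in> U \<Longrightarrow> R K \<in> ?A" "\<exists>K\<in>U. R K \<noteq> 0" "\<And>J. J \<in> E \<Longrightarrow> (\<Sum>K\<in>U. m J K * R K) = 0"
    by blast
  have conv: "conv_coeff n L R a J = (\<Sum>K\<in>U. m J K * R K)" for J
  proof
    fix z
    have "(\<Sum>K\<in>U. m J K * R K) z = (\<Sum>K\<in>U. m J K z * R K z)" by (simp add: sum_fun_apply)
    also have "\<dots> = (\<Sum>K\<in>{K\<in>U. K \<le> J}. m J K z * R K z)"
      using finU by (intro sum.mono_neutral_right) (auto simp: m_def)
    also have "\<dots> = conv_coeff n L R a J z"
      unfolding conv_coeff_def by (intro sum.cong) (auto simp: U_def m_def)
    finally show "conv_coeff n L R a J z = (\<Sum>K\<in>U. m J K * R K) z" ..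
  qed
  define S where "S = {K \<in> U. R K \<noteq> 0}"
  have "S \<subseteq> multi_idx n" "T \<subseteq> multi_idx n" "S \<noteq> {}" using R(2) by (auto simp: S_def U_def T_def)
  \<comment> \<open>At \<open>s + t\<close> the convolution has a single nonzero term,
    \<open>a t * R s\<close>, so nothing can cancel.\<close>
  from ex_uniquely_represented_sum[OF this \<open>T \<noteq> {}\<close>]
  obtain s t where st: "s \<in> S" "t \<in> T" "\<And>t'. t' \<in> T \<Longrightarrow> mdeg n t \<le> mdeg n t'"
    "\<And>s' t'. s' \<in> S \<Longrightarrow> t' \<in> T \<Longrightarrow> s' + t' = s + t \<Longrightarrow> s' = s \<and> t' = t" by metis
  have "mdeg n t = p" using st(2,3) I1 by (auto simp: p_def intro: antisym)
  let ?J = "s + t"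
  have sU: "s \<in> U" "s \<in> multi_idx n" "t \<in> multi_idx n" using st by (auto simp: S_def U_def T_def)
  then have J: "?J \<in> multi_idx n" by (auto simp: multi_idx_def)
  \<comment> \<open>This is why the degree of \<open>R\<close> stops \<open>p\<close> short of
    \<open>\<kappa> * x\<close>: the nonzero coefficient lies below degree
    \<open>\<kappa> * x\<close> and, since the system kills all degrees from \<open>x\<close> on,
    even below \<open>x\<close>.\<close>
  have "mdeg n ?J < \<kappa> * x" using sU \<open>mdeg n t = p\<close> by (auto simp: mdeg_add U_def L_def)
  have "(\<Sum>K\<in>U. m ?J K * R K) = (\<Sum>K\<in>{s}. m ?J K * R K)"
  proof (rule sum.mono_neutral_right[OF finU])
    show "\<forall>K\<in>U - {s}. m ?J K * R K = 0"
    proof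
      fix K assume K: "K \<in> U - {s}"
      show "m ?J K * R K = 0"
      proof (rule ccontr)
        assume "m ?J K * R K \<noteq> 0"
        then have *: "m ?J K \<noteq> 0" "R K \<noteq> 0" by auto
        then have le: "K \<le> ?J" and "a (\<lambda>k. ?J k - K k) \<noteq> 0" by (auto simp: m_def split: if_splits)
        then have "(\<lambda>k. ?J k - K k) \<in> T" using multi_idx_diff[OF J] by (simp add: T_def)
        moreover have "K \<in> S" using K * by (simp add: S_def)
        ultimately have "K = s" using st(4) add_diff_multi_idx[OF le] by blast
        with K show False by simp
      qed
    qed
  qed (use sU in auto)
  also have "\<dots> = a t * R s"
  proof -
    have "s \<le> s + t" "(\<lambda>k. (s + t) k - s k) = t" by (auto simp: le_fun_def)
    then show ?thesis by (simp add: m_def)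
  qed
  finally have "conv_coeff n L R a ?J \<noteq> 0"
    unfolding conv using domA[OF gen[OF sU(3)] R(1)[OF sU(1)]] st by (simp add: S_def T_def)
  moreover from this have "mdeg n ?J < x"
    using R(3)[of ?J] J \<open>mdeg n ?J < \<kappa> * x\<close> unfolding conv by (force simp: E_def)
  ultimately have "\<exists>J\<in>multi_idx n. mdeg n J < x \<and> conv_coeff n L R a J \<noteq> (\<lambda>z. 0)"
    using J by (auto simp: zero_fun_def)
  moreover have "conv_coeff n L R a J = (\<lambda>z. 0)" if "J \<in> multi_idx n" "x \<le> mdeg n J" "mdeg n J < \<kappa> * x" for J
    using R(3)[of J] that unfolding conv by (simp add: E_def zero_fun_def)
  moreover have "L \<le> \<kappa> * x" by (simp add: L_def)
  ultimately show ?thesis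
    using x(1) R(1) by (intro that[of x L R]) (auto simp: U_def)
qed

lemma mpow_add: "mpow n w (I + J) = mpow n w I * mpow n w J"
  by (simp add: mpow_def power_add prod.distrib plus_fun_def)

lemma sum_multi_idx_by_degree:
  "(\<Sum>I\<in>{I\<in>multi_idx n. mdeg n I < d}. g I) = (\<Sum>j<d. \<Sum>I\<in>{I\<in>multi_idx n. mdeg n I = j}. g I)"
proof -
  have "(\<Sum>j<d. \<Sum>I\<in>{I\<in>multi_idx n. mdeg n I = j}. g I) = sum g (\<Union>j<d. {I\<in>multi_idx n. mdeg n I = j})"
    by (rule sum.UNION_disjoint[symmetric]) (auto intro: finite_multi_idx_eq)
  also have "(\<Union>j<d. {I\<in>multi_idx n. mdeg n I = j}) = {I\<in>multi_idx n. mdeg n I < d}" by auto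
  finally show ?thesis ..
qed

text \<open>With \<open>J = K + I\<close>, truncating the product below degree \<open>N\<close>
  means truncating the series below \<open>N - mdeg n K\<close> next to \<open>w ^ K\<close>. Where
  the series sums to 0, each such truncation is minus a tail.\<close>

lemma sum_conv_coeff:
  "(\<Sum>J\<in>{J\<in>multi_idx n. mdeg n J < N}. conv_coeff n L R a J z * mpow n w J) =
   (\<Sum>K\<in>{K\<in>multi_idx n. mdeg n K < L}. R K z * mpow n w K * (\<Sum>d<N - mdeg n K. ps_part n a z w d))"
proof -
  let ?U = "{K\<in>multi_idx n. mdeg n K < L}" and ?V = "{J\<in>multi_idx n. mdeg n J < N}"
  have fin: "finite ?U" "finite ?V" by (rule finite_multi_idx_less)+
  have "(\<Sum>J\<in>?V. conv_coeff n L R a J z * mpow n w J) =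
     (\<Sum>J\<in>?V. \<Sum>K\<in>{K\<in>?U. K \<le> J}. R K z * a (\<lambda>k. J k - K k) z * mpow n w J)"
    unfolding conv_coeff_def sum_distrib_right by (intro sum.cong refl) auto
  also have "\<dots> = (\<Sum>K\<in>?U. \<Sum>J\<in>{J\<in>?V. K \<le> J}. R K z * a (\<lambda>k. J k - K k) z * mpow n w J)"
    by (rule sum.swap_restrict[OF fin(2,1)])
  also have "\<dots> = (\<Sum>K\<in>?U. R K z * mpow n w K * (\<Sum>d<N - mdeg n K. ps_part n a z w d))"
  proof (rule sum.cong[OF refl])
    fix K assume K: "K \<in> ?U"
    have "(\<Sum>J\<in>{J\<in>?V. K \<le> J}. R K z * a (\<lambda>k. J k - K k) z * mpow n w J) =
       (\<Sum>I\<in>{I\<in>multi_idx n. mdeg n I < N - mdeg n K}. R K z * a I z * mpow n w (K + I))"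
    proof (rule sum.reindex_bij_witness[where i = "\<lambda>I. K + I" and j = "\<lambda>J k. J k - K k"])
      fix J assume J: "J \<in> {J\<in>?V. K \<le> J}"
      then show eq: "K + (\<lambda>k. J k - K k) = J" by (simp add: add_diff_multi_idx)
      from J have "(\<lambda>k. J k - K k) \<in> multi_idx n" by (simp add: multi_idx_diff)
      moreover have "mdeg n K + mdeg n (\<lambda>k. J k - K k) = mdeg n J" using eq by (metis mdeg_add)
      ultimately show "(\<lambda>k. J k - K k) \<in> {I\<in>multi_idx n. mdeg n I < N - mdeg n K}" using J by auto
      show "R K z * a (\<lambda>k. J k - K k) z * mpow n w (K + (\<lambda>k. J k - K k)) = R K z * a (\<lambda>k. J k - K k) z * mpow n w J"
        using eq by simp
    next
      fix I assume "I \<in> {I\<in>multi_idx n. mdeg n I < N - mdeg n K}"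
      then show "(\<lambda>k. (K + I) k - K k) = I" "K + I \<in> {J\<in>?V. K \<le> J}"
        using K by (auto simp: mdeg_add multi_idx_def le_fun_def)
    qed
    also have "\<dots> = R K z * mpow n w K * (\<Sum>I\<in>{I\<in>multi_idx n. mdeg n I < N - mdeg n K}. a I z * mpow n w I)"
      by (simp add: mpow_add sum_distrib_left mult_ac)
    also have "\<dots> = R K z * mpow n w K * (\<Sum>d<N - mdeg n K. ps_part n a z w d)"
      unfolding sum_multi_idx_by_degree ps_part_def ..
    finally show "(\<Sum>J\<in>{J\<in>?V. K \<le> J}. R K z * a (\<lambda>k. J k - K k) z * mpow n w J) =
      R K z * mpow n w K * (\<Sum>d<N - mdeg n K. ps_part n a z w d)" .
  qed
  finally show ?thesis .
qed

section \<open>Estimates for the gap polynomial\<close>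

lemma lnplus_mult_le: "lnplus (x * y) \<le> lnplus x + lnplus y"
proof (cases "x = top \<or> y = top")
  case True then show ?thesis by auto
next
  case False
  then obtain p q where pq: "x = ennreal p" "0 \<le> p" "y = ennreal q" "0 \<le> q"
    by (cases x rule: ennreal_cases; cases y rule: ennreal_cases) auto
  have "max 0 (ln (p * q)) \<le> max 0 (ln p) + max 0 (ln q)"
  proof (cases "p = 0 \<or> q = 0")
    case False
    then have "ln (p * q) = ln p + ln q" using pq by (simp add: ln_mult)
    then show ?thesis by linarith
  qed auto
  then have "ennreal (max 0 (ln (p * q))) \<le> ennreal (max 0 (ln p) + max 0 (ln q))"
    by (rule ennreal_leI)
  then show ?thesis using pq by (simp add: lnplus_ennreal ennreal_plus flip: ennreal_mult)
qed

lemma lnplus_1 [simp]: "lnplus 1 = 0"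
  using lnplus_ennreal[of 1] by simp

lemma lnplus_power_le: "lnplus (x ^ k) \<le> of_nat k * lnplus x"
proof (induction k)
  case (Suc k)
  have "lnplus (x ^ Suc k) \<le> lnplus x + lnplus (x ^ k)" using lnplus_mult_le[of x "x ^ k"] by simp
  also have "\<dots> \<le> lnplus x + of_nat k * lnplus x" using Suc by (rule add_left_mono)
  finally show ?case by (simp add: distrib_right)
qed simp

lemma lnplus_power_ennreal:
  assumes "0 < y" shows "lnplus (ennreal y ^ k) = of_nat k * lnplus (ennreal y)"
proof -
  have "max 0 (real k * ln y) = real k * max 0 (ln y)" by (simp add: max_def zero_le_mult_iff)
  then show ?thesis using assms
    by (simp add: lnplus_ennreal ennreal_power ln_realpow ennreal_mult ennreal_of_nat_eq_real_of_nat)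
qed

lemma lnplus_one_plus_le: "lnplus (1 + x) \<le> ennreal (ln 2) + lnplus x"
proof -
  have "1 + x \<le> 2 * max 1 x" by (metis add_mono max.cobounded1 max.cobounded2 mult_2)
  then have "lnplus (1 + x) \<le> lnplus (2 * max 1 x)" by (rule lnplus_mono)
  also have "\<dots> \<le> lnplus 2 + lnplus (max 1 x)" by (rule lnplus_mult_le)
  also have "lnplus (max 1 x) \<le> lnplus x"
    by (cases "1 \<le> x") (auto simp: max_absorb1 max_absorb2)
  also have "lnplus 2 = ennreal (ln 2)" using lnplus_ennreal[of 2] by simp
  finally show ?thesis by (simp add: add_left_mono)
qed

lemma lnplus_max_one: "lnplus (ennreal (max 1 y)) = lnplus (ennreal y)"
proof (cases "1 \<le> y")
  case False
  then have "lnplus (ennreal y) \<le> lnplus 1" by (intro lnplus_mono) (simp add: ennreal_le_1)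
  with False show ?thesis by (simp add: max_absorb1)
qed (simp add: max_absorb2)

lemma lnplus_prod_le:
  "finite S \<Longrightarrow> (\<And>i. i \<in> S \<Longrightarrow> 0 \<le> g i) \<Longrightarrow> lnplus (ennreal (\<Prod>i\<in>S. g i)) \<le> (\<Sum>i\<in>S. lnplus (ennreal (g i)))"
proof (induction S rule: finite_induct)
  case (insert i S)
  then have "lnplus (ennreal (g i * prod g S)) \<le> lnplus (ennreal (g i)) + lnplus (ennreal (prod g S))"
    by (subst ennreal_mult) (auto intro: lnplus_mult_le prod_nonneg)
  also have "\<dots> \<le> lnplus (ennreal (g i)) + (\<Sum>i\<in>S. lnplus (ennreal (g i)))"
    using insert by (intro add_left_mono) auto
  finally show ?case using insert by simp
qed simp

lemma norm_mpow_le: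
  assumes "\<And>k. k < n \<Longrightarrow> norm (w k :: complex) \<le> \<rho>"
  shows "norm (mpow n w I) \<le> \<rho> ^ mdeg n I"
proof -
  have "norm (mpow n w I) = (\<Prod>k<n. norm (w k) ^ I k)" by (simp add: mpow_def prod_norm[symmetric] norm_power)
  also have "\<dots> \<le> (\<Prod>k<n. \<rho> ^ I k)" using assms by (intro prod_mono conjI power_mono) auto
  also have "\<dots> = \<rho> ^ mdeg n I" by (simp add: mdeg_def power_sum)
  finally show ?thesis .
qed

text \<open>The function of the smallness hypothesis, grouped by degree exactly as there, and
  extended-real valued because it may diverge at some points.\<close>

definition coeff_norm :: "nat \<Rightarrow> ((nat \<Rightarrow> nat) \<Rightarrow> 'x \<Rightarrow> complex) \<Rightarrow> 'x \<Rightarrow> ennreal" where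
  "coeff_norm n a z = (\<Sum>d. \<Sum>I\<in>{I\<in>multi_idx n. mdeg n I = d}. ennreal (cmod (a I z)))"

lemma cmod_le_coeff_norm:
  assumes "I \<in> multi_idx n" shows "ennreal (cmod (a I z)) \<le> coeff_norm n a z"
proof -
  let ?S = "\<lambda>d. \<Sum>I\<in>{I\<in>multi_idx n. mdeg n I = d}. ennreal (cmod (a I z))"
  have "ennreal (cmod (a I z)) \<le> ?S (mdeg n I)"
    using assms by (intro member_le_sum finite_multi_idx_eq) auto
  also have "\<dots> \<le> (\<Sum>d. ?S d)" using sum_le_suminf[of ?S "{mdeg n I}"] by (simp add: summableI)
  finally show ?thesis unfolding coeff_norm_def .
qed

text \<open>The base \<open>1 + coeff_norm n a z\<close> is at least 1, so its powers increase with
  the exponent and two bounds merge at the exponent \<open>s + t\<close>.\<close>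

lemma poly_ring_of_growth:
  assumes "g \<in> poly_ring_of (a ` multi_idx n)"
  shows "\<exists>C s. \<forall>z. ennreal (cmod (g z)) \<le> ennreal C * (1 + coeff_norm n a z) ^ s"
  using assms
proof induction
  case (gen g)
  then obtain I where I: "I \<in> multi_idx n" "g = a I" by auto
  have "ennreal (cmod (a I z)) \<le> ennreal 1 * (1 + coeff_norm n a z) ^ 1" for z
    using cmod_le_coeff_norm[OF I(1), of a z] by (simp add: add_increasing)
  then show ?case unfolding I(2) by blast
next
  case (const c)
  have "ennreal (cmod c) \<le> ennreal (cmod c) * (1 + coeff_norm n a z) ^ 0" for z by simp
  then show ?case by blast
next
  case (add g h)
  then obtain C s D t where b: "\<And>z. ennreal (cmod (g z)) \<le> ennreal C * (1 + coeff_norm n a z) ^ s"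
    "\<And>z. ennreal (cmod (h z)) \<le> ennreal D * (1 + coeff_norm n a z) ^ t" by blast
  have "ennreal (cmod (g z + h z)) \<le> ennreal (\<bar>C\<bar> + \<bar>D\<bar>) * (1 + coeff_norm n a z) ^ (s + t)" for z
  proof -
    have "ennreal (cmod (g z + h z)) \<le> ennreal (cmod (g z)) + ennreal (cmod (h z))"
      by (simp add: norm_triangle_ineq flip: ennreal_plus)
    also have "\<dots> \<le> ennreal C * (1 + coeff_norm n a z) ^ s + ennreal D * (1 + coeff_norm n a z) ^ t"
      by (intro add_mono b)
    also have "\<dots> \<le> ennreal \<bar>C\<bar> * (1 + coeff_norm n a z) ^ (s + t) + ennreal \<bar>D\<bar> * (1 + coeff_norm n a z) ^ (s + t)"
      by (intro add_mono mult_mono ennreal_leI power_increasing) auto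
    finally show ?thesis by (simp add: distrib_right ennreal_plus)
  qed
  then show ?case by blast
next
  case (mult g h)
  then obtain C s D t where b: "\<And>z. ennreal (cmod (g z)) \<le> ennreal C * (1 + coeff_norm n a z) ^ s"
    "\<And>z. ennreal (cmod (h z)) \<le> ennreal D * (1 + coeff_norm n a z) ^ t" by blast
  have "ennreal (cmod (g z * h z)) \<le> ennreal (\<bar>C\<bar> * \<bar>D\<bar>) * (1 + coeff_norm n a z) ^ (s + t)" for z
  proof -
    have "ennreal (cmod (g z * h z)) = ennreal (cmod (g z)) * ennreal (cmod (h z))"
      by (simp add: norm_mult ennreal_mult)
    also have "\<dots> \<le> (ennreal \<bar>C\<bar> * (1 + coeff_norm n a z) ^ s) * (ennreal \<bar>D\<bar> * (1 + coeff_norm n a z) ^ t)"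
      by (intro mult_mono order.trans[OF b(1)] order.trans[OF b(2)] mult_right_mono ennreal_leI) auto
    finally show ?thesis by (simp add: ennreal_mult power_add mult_ac)
  qed
  then show ?case by blast
qed

text \<open>Coefficients that are polynomials in the \<open>a\<^sub>I\<close> cost only a constant
  and a multiple of log^+ of the coefficient norm, hence a small error after averaging.\<close>

lemma lnplus_sum_poly_ring_of:
  assumes "finite S" "\<And>i. i \<in> S \<Longrightarrow> g i \<in> poly_ring_of (a ` multi_idx n)"
  shows "\<exists>C s. C < \<infinity> \<and> (\<forall>z. lnplus (\<Sum>i\<in>S. ennreal (cmod (g i z))) \<le> C + of_nat s * lnplus (coeff_norm n a z))"
proof -
  have "\<exists>C s. \<forall>z. (\<Sum>i\<in>S. ennreal (cmod (g i z))) \<le> ennreal C * (1 + coeff_norm n a z) ^ s"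
    using assms
  proof (induction S rule: finite_induct)
    case empty then show ?case by auto
  next
    case (insert i S)
    then obtain D t where D: "\<And>z. (\<Sum>i\<in>S. ennreal (cmod (g i z))) \<le> ennreal D * (1 + coeff_norm n a z) ^ t" by auto
    obtain C s where C: "\<And>z. ennreal (cmod (g i z)) \<le> ennreal C * (1 + coeff_norm n a z) ^ s"
      using poly_ring_of_growth[of "g i" a n] insert.prems by auto
    have "(\<Sum>i\<in>insert i S. ennreal (cmod (g i z))) \<le> ennreal (\<bar>C\<bar> + \<bar>D\<bar>) * (1 + coeff_norm n a z) ^ (s + t)" for z
    proof -
      have "(\<Sum>i\<in>insert i S. ennreal (cmod (g i z))) \<le> ennreal C * (1 + coeff_norm n a z) ^ s + ennreal D * (1 + coeff_norm n a z) ^ t"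
        unfolding sum.insert[OF insert.hyps] by (intro add_mono C D)
      also have "\<dots> \<le> ennreal \<bar>C\<bar> * (1 + coeff_norm n a z) ^ (s + t) + ennreal \<bar>D\<bar> * (1 + coeff_norm n a z) ^ (s + t)"
        by (intro add_mono mult_mono ennreal_leI power_increasing) auto
      finally show ?thesis by (simp add: distrib_right ennreal_plus)
    qed
    then show ?case by blast
  qed
  then obtain C s where C: "\<And>z. (\<Sum>i\<in>S. ennreal (cmod (g i z))) \<le> ennreal C * (1 + coeff_norm n a z) ^ s" by blast
  have "lnplus (\<Sum>i\<in>S. ennreal (cmod (g i z))) \<le> (lnplus (ennreal C) + of_nat s * ennreal (ln 2)) + of_nat s * lnplus (coeff_norm n a z)" for z
  proof -
    have "lnplus (\<Sum>i\<in>S. ennreal (cmod (g i z))) \<le> lnplus (ennreal C) + lnplus ((1 + coeff_norm n a z) ^ s)"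
      by (rule order.trans[OF lnplus_mono[OF C] lnplus_mult_le])
    also have "\<dots> \<le> lnplus (ennreal C) + of_nat s * (ennreal (ln 2) + lnplus (coeff_norm n a z))"
      by (intro add_left_mono order.trans[OF lnplus_power_le] mult_left_mono lnplus_one_plus_le) auto
    finally show ?thesis by (simp add: distrib_left add.assoc)
  qed
  moreover have "lnplus (ennreal C) + of_nat s * ennreal (ln 2) < \<infinity>"
    using lnplus_const_finite[of C] by (simp add: ennreal_mult_less_top of_nat_less_top)
  ultimately show ?thesis by blast
qed

text \<open>A common bound for all \<open>|f i / f 0|\<close>. It is a product in place of a
  maximum, because its log^+ is at most the sum of the log^+ of the quotients, whose means are small
  by hypothesis.\<close>

definition quot_bound :: "nat \<Rightarrow> (nat \<Rightarrow> 'x \<Rightarrow> complex) \<Rightarrow> 'x \<Rightarrow> real" where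
  "quot_bound n f z = (\<Prod>i<n. max 1 (cmod (f i z / f 0 z)))"

lemma quot_bound_ge_1: "1 \<le> quot_bound n f z"
  unfolding quot_bound_def by (intro prod_ge_1) auto

lemma norm_le_quot_bound:
  assumes "f 0 z \<noteq> 0" "k < n" shows "cmod (f k z) \<le> cmod (f 0 z) * quot_bound n f z"
proof -
  have "max 1 (cmod (f k z / f 0 z)) \<le> quot_bound n f z"
  proof -
    have "quot_bound n f z = max 1 (cmod (f k z / f 0 z)) * (\<Prod>i\<in>{..<n} - {k}. max 1 (cmod (f i z / f 0 z)))"
      unfolding quot_bound_def using assms by (subst prod.remove[of _ k]) auto
    moreover have "1 \<le> (\<Prod>i\<in>{..<n} - {k}. max 1 (cmod (f i z / f 0 z)))" by (intro prod_ge_1) auto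
    ultimately show ?thesis using mult_left_mono[of 1 _ "max 1 (cmod (f k z / f 0 z))"] by simp
  qed
  then have "cmod (f k z / f 0 z) \<le> quot_bound n f z" by simp
  then show ?thesis using assms by (simp add: norm_divide field_simps)
qed

lemma lnplus_quot_bound_le:
  "lnplus (ennreal (quot_bound n f z)) \<le> (\<Sum>i<n. lnplus (ennreal (cmod (f i z / f 0 z))))"
  unfolding quot_bound_def by (rule order.trans[OF lnplus_prod_le]) (auto simp: lnplus_max_one)

text \<open>Summing the identity of \<open>sum_conv_coeff\<close> against \<open>G = 0\<close> turns the truncated sums into tails, which are
  small of order \<open>N\<close> in \<open>\<rho>\<close>.\<close>
lemma norm_gap_polynomial_le:
  fixes w :: "nat \<Rightarrow> complex"
  assumes L: "L \<le> N" and sm: "summable (ps_part n a z w)" and zero: "(\<Sum>d. ps_part n a z w d) = 0"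
    and w: "\<And>k. k < n \<Longrightarrow> cmod (w k) \<le> \<rho>" and \<rho>: "0 \<le> \<rho>" "\<rho> \<le> 1" and fin: "coeff_norm n a z < \<infinity>"
  shows "ennreal (cmod (\<Sum>J\<in>{J\<in>multi_idx n. mdeg n J < N}. conv_coeff n L R a J z * mpow n w J))
    \<le> (\<Sum>K\<in>{K\<in>multi_idx n. mdeg n K < L}. ennreal (cmod (R K z))) * coeff_norm n a z * ennreal (\<rho> ^ N)"
proof -
  define A where "A d = (\<Sum>I\<in>{I\<in>multi_idx n. mdeg n I = d}. cmod (a I z))" for d
  have A0: "0 \<le> A d" for d unfolding A_def by (intro sum_nonneg) auto
  have cn: "coeff_norm n a z = (\<Sum>d. ennreal (A d))"
    unfolding coeff_norm_def A_def by simp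
  have sA: "summable A"
    using fin A0 unfolding cn by (intro summable_suminf_not_top) auto
  have cnA: "coeff_norm n a z = ennreal (suminf A)"
    unfolding cn using A0 sA by (intro suminf_ennreal2) auto
  have ps: "cmod (ps_part n a z w d) \<le> \<rho> ^ d * A d" for d
  proof -
    have "cmod (ps_part n a z w d) \<le> (\<Sum>I\<in>{I\<in>multi_idx n. mdeg n I = d}. cmod (a I z * mpow n w I))"
      unfolding ps_part_def by (rule norm_sum)
    also have "\<dots> \<le> (\<Sum>I\<in>{I\<in>multi_idx n. mdeg n I = d}. cmod (a I z) * \<rho> ^ d)"
      using norm_mpow_le[of n w \<rho>, OF w] by (intro sum_mono) (auto simp: norm_mult intro!: mult_left_mono)
    also have "\<dots> = A d * \<rho> ^ d" by (simp add: A_def sum_distrib_right)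
    finally show ?thesis by (simp only: mult.commute)
  qed
  have tail: "cmod (\<Sum>d<M. ps_part n a z w d) \<le> \<rho> ^ M * suminf A" for M
  proof -
    have "(\<Sum>d<M. ps_part n a z w d) = - (\<Sum>d. ps_part n a z w (d + M))"
      using suminf_split_initial_segment[OF sm, of M] zero by (simp add: eq_neg_iff_add_eq_0 add.commute)
    also have "cmod \<dots> \<le> (\<Sum>d. \<rho> ^ M * A (d + M))"
      unfolding norm_minus_cancel
    proof (rule norm_suminf_le)
      show "cmod (ps_part n a z w (d + M)) \<le> \<rho> ^ M * A (d + M)" for d
        using ps[of "d + M"] mult_right_mono[OF power_decreasing[of M "d + M" \<rho>], of "A (d + M)"] \<rho> A0[of "d + M"]
        by simp
      show "summable (\<lambda>d. \<rho> ^ M * A (d + M))" using sA by (intro summable_mult summable_ignore_initial_segment)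
    qed
    also have "\<dots> = \<rho> ^ M * (\<Sum>d. A (d + M))"
      using sA by (intro suminf_mult summable_ignore_initial_segment)
    also have "\<dots> \<le> \<rho> ^ M * suminf A"
      using \<rho> suminf_split_initial_segment[OF sA, of M] sum_nonneg[of "{..<M}" A] A0 by (intro mult_left_mono) auto
    finally show ?thesis .
  qed
  let ?U = "{K\<in>multi_idx n. mdeg n K < L}"
  have "cmod (\<Sum>K\<in>?U. R K z * mpow n w K * (\<Sum>d<N - mdeg n K. ps_part n a z w d)) \<le> (\<Sum>K\<in>?U. cmod (R K z) * suminf A * \<rho> ^ N)"
  proof (rule sum_norm_le)
    fix K assume K: "K \<in> ?U"
    have "cmod (R K z * mpow n w K * (\<Sum>d<N - mdeg n K. ps_part n a z w d)) \<le>
       cmod (R K z) * \<rho> ^ mdeg n K * (\<rho> ^ (N - mdeg n K) * suminf A)"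
      unfolding norm_mult using \<rho> by (intro mult_mono mult_left_mono norm_mpow_le w tail) auto
    also have "\<dots> = cmod (R K z) * suminf A * (\<rho> ^ mdeg n K * \<rho> ^ (N - mdeg n K))" by (simp add: mult_ac)
    \<comment> \<open>\<open>L \<le> N\<close> makes the natural subtraction exact, so the powers
      from \<open>w ^ K\<close> and from the tail recombine to the same \<open>\<rho> ^ N\<close>
      for every \<open>K\<close>.\<close>
    also have "\<rho> ^ mdeg n K * \<rho> ^ (N - mdeg n K) = \<rho> ^ N" using K L by (simp flip: power_add)
    finally show "cmod (R K z * mpow n w K * (\<Sum>d<N - mdeg n K. ps_part n a z w d)) \<le> cmod (R K z) * suminf A * \<rho> ^ N" .
  qed
  also have "\<dots> = (\<Sum>K\<in>?U. cmod (R K z)) * suminf A * \<rho> ^ N" by (simp add: sum_distrib_right)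
  finally have "ennreal (cmod (\<Sum>K\<in>?U. R K z * mpow n w K * (\<Sum>d<N - mdeg n K. ps_part n a z w d)))
     \<le> ennreal ((\<Sum>K\<in>?U. cmod (R K z)) * suminf A * \<rho> ^ N)" by (rule ennreal_leI)
  also have "\<dots> = (\<Sum>K\<in>?U. ennreal (cmod (R K z))) * coeff_norm n a z * ennreal (\<rho> ^ N)"
    unfolding cnA using \<rho> suminf_nonneg[OF sA A0] by (simp add: ennreal_mult sum_nonneg)
  finally show ?thesis unfolding sum_conv_coeff .
qed

text \<open>Let \<open>\<rho> = |f 0| * M\<close> with \<open>M\<close> the quotient bound. If
  \<open>\<rho> \<ge> 1\<close>, then \<open>1 / |f 0| \<le> M\<close> suffices. Otherwise the gap
  estimate, divided by \<open>|P| * \<rho> ^ N\<close>, bounds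
  \<open>1 / |f 0| ^ N = M ^ N / \<rho> ^ N\<close>.\<close>

lemma lnplus_inverse_gap_polynomial:
  fixes f :: "nat \<Rightarrow> 'x \<Rightarrow> complex"
  assumes L: "L \<le> N" and sm: "summable (ps_part n a z (\<lambda>k. f k z))"
    and zero: "(\<Sum>d. ps_part n a z (\<lambda>k. f k z) d) = 0"
    and P: "P = (\<Sum>J\<in>{J\<in>multi_idx n. mdeg n J < N}. conv_coeff n L R a J z * mpow n (\<lambda>k. f k z) J)"
  shows "of_nat N * lnplus (ennreal (cmod (inverse (f 0 z))))
    \<le> lnplus (inverse (ennreal (cmod P))) + of_nat N * (\<Sum>i<n. lnplus (ennreal (cmod (f i z / f 0 z))))
      + lnplus (\<Sum>K\<in>{K\<in>multi_idx n. mdeg n K < L}. ennreal (cmod (R K z))) + lnplus (coeff_norm n a z)"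
    (is "?lhs \<le> ?p + of_nat N * ?\<Lambda> + lnplus ?S + lnplus ?A")
proof -
  define M where "M = quot_bound n f z"
  have M: "1 \<le> M" "lnplus (ennreal M) \<le> ?\<Lambda>"
    unfolding M_def by (rule quot_bound_ge_1 lnplus_quot_bound_le)+
  \<comment> \<open>In the first case the left side is 0, since the complex \<open>inverse 0\<close>
    is 0; for \<open>P = 0\<close> or an infinite coefficient norm the right side is
    infinite.\<close>
  consider "f 0 z = 0" | "f 0 z \<noteq> 0" "1 \<le> cmod (f 0 z) * M" | "P = 0" | "?A = top"
    | "f 0 z \<noteq> 0" "cmod (f 0 z) * M < 1" "P \<noteq> 0" "?A < top"
    by (metis less_top not_le)
  then show ?thesis
  proof cases
    case 2
    have "inverse (cmod (f 0 z)) \<le> M" using 2 by (simp add: field_simps)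
    then have "cmod (inverse (f 0 z)) \<le> M" by (simp only: norm_inverse)
    then have "lnplus (ennreal (cmod (inverse (f 0 z)))) \<le> ?\<Lambda>"
      by (intro order.trans[OF lnplus_mono[OF ennreal_leI] M(2)])
    then have "?lhs \<le> of_nat N * ?\<Lambda>" by (rule mult_left_mono) simp
    then show ?thesis by (simp add: add_increasing add_increasing2)
  next
    case 5
    let ?\<rho> = "cmod (f 0 z) * M"
    have \<rho>: "0 < ?\<rho>" "?\<rho> \<le> 1" using 5 M by (auto intro: mult_pos_pos)
    have "ennreal (cmod P) \<le> ?S * ?A * ennreal (?\<rho> ^ N)"
      unfolding P using \<rho> 5
      by (intro norm_gap_polynomial_le L sm zero) (auto simp: M_def intro: norm_le_quot_bound)
    then have "ennreal (1 / ?\<rho> ^ N) * ennreal (cmod P) \<le> ennreal (1 / ?\<rho> ^ N) * (?S * ?A * ennreal (?\<rho> ^ N))"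
      by (rule mult_left_mono) simp
    also have "\<dots> = ?S * ?A * (ennreal (1 / ?\<rho> ^ N) * ennreal (?\<rho> ^ N))" by (simp add: mult_ac)
    also have "ennreal (1 / ?\<rho> ^ N) * ennreal (?\<rho> ^ N) = 1"
    proof -
      have "?\<rho> ^ N \<noteq> 0" using \<rho>(1) by (metis less_irrefl power_not_zero)
      then have "1 / ?\<rho> ^ N * ?\<rho> ^ N = 1" by (rule nonzero_divide_eq_eq[THEN iffD1, OF _ refl, symmetric])
      then show ?thesis using \<rho>(1) by (simp only: ennreal_mult[symmetric] zero_le_divide_1_iff zero_le_power less_imp_le ennreal_1)
    qed
    finally have "ennreal (1 / ?\<rho> ^ N) * ennreal (cmod P) * inverse (ennreal (cmod P)) \<le> ?S * ?A * inverse (ennreal (cmod P))"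
      by (intro mult_right_mono) auto
    also have "ennreal (1 / ?\<rho> ^ N) * ennreal (cmod P) * inverse (ennreal (cmod P)) = ennreal (1 / ?\<rho> ^ N)"
      using 5 by (simp add: inverse_ennreal mult.assoc flip: ennreal_mult)
    finally have le: "ennreal (1 / ?\<rho> ^ N) \<le> ?S * ?A * inverse (ennreal (cmod P))" .
    have "cmod (inverse (f 0 z)) ^ N = M ^ N * (1 / ?\<rho> ^ N)"
    proof -
      have "cmod (inverse (f 0 z)) = M / ?\<rho>" using 5 M by (simp add: norm_inverse divide_inverse)
      then show ?thesis by (simp only: power_divide times_divide_eq_right mult_1_right)
    qed
    then have "ennreal (cmod (inverse (f 0 z))) ^ N = ennreal M ^ N * ennreal (1 / ?\<rho> ^ N)"
      using M \<rho> by (simp add: ennreal_power flip: ennreal_mult)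
    also have "\<dots> \<le> ennreal M ^ N * (?S * ?A * inverse (ennreal (cmod P)))"
      by (rule mult_left_mono[OF le]) simp
    finally have "lnplus (ennreal (cmod (inverse (f 0 z))) ^ N) \<le> lnplus (ennreal M ^ N * (?S * ?A * inverse (ennreal (cmod P))))"
      by (rule lnplus_mono)
    also have "\<dots> \<le> of_nat N * ?\<Lambda> + (lnplus ?S + lnplus ?A + ?p)"
      by (intro order.trans[OF lnplus_mult_le] add_mono order.trans[OF lnplus_power_le] mult_left_mono M order_refl) auto
    finally show ?thesis using 5 by (simp add: lnplus_power_ennreal add_ac)
  qed auto
qed

text \<open>All \<open>|f k|\<close> are at most \<open>max 1 |f 0|\<close> times the quotient
  bound; this majorant is at least 1, so its \<open>x\<close>-th power also covers monomials of
  lower degree.\<close>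

lemma lnplus_polynomial_le:
  fixes f :: "nat \<Rightarrow> 'x \<Rightarrow> complex"
  assumes "f 0 z \<noteq> 0" "finite F" "\<And>J. J \<in> F \<Longrightarrow> mdeg n J \<le> x"
  shows "lnplus (ennreal (cmod (\<Sum>J\<in>F. c J z * mpow n (\<lambda>k. f k z) J)))
    \<le> of_nat x * (lnplus (ennreal (cmod (f 0 z))) + (\<Sum>i<n. lnplus (ennreal (cmod (f i z / f 0 z)))))
      + lnplus (\<Sum>J\<in>F. ennreal (cmod (c J z)))" (is "_ \<le> of_nat x * (?f + ?\<Lambda>) + lnplus ?S")
proof -
  define M where "M = quot_bound n f z"
  have M: "1 \<le> M" "lnplus (ennreal M) \<le> ?\<Lambda>"
    unfolding M_def by (rule quot_bound_ge_1 lnplus_quot_bound_le)+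
  let ?\<tau> = "max 1 (cmod (f 0 z)) * M"
  have \<tau>: "1 \<le> ?\<tau>" using M mult_mono[of 1 "max 1 (cmod (f 0 z))" 1 M] by simp
  have "cmod (f k z) \<le> ?\<tau>" if "k < n" for k
    using that M(1) unfolding M_def
    by (intro order.trans[OF norm_le_quot_bound[of f z k n, OF assms(1)] mult_right_mono]) auto
  then have mp: "cmod (mpow n (\<lambda>k. f k z) J) \<le> ?\<tau> ^ x" if "J \<in> F" for J
    by (rule order.trans[OF norm_mpow_le power_increasing[OF assms(3)[OF that] \<tau>]])
  have "cmod (\<Sum>J\<in>F. c J z * mpow n (\<lambda>k. f k z) J) \<le> (\<Sum>J\<in>F. cmod (c J z) * ?\<tau> ^ x)"
    by (rule sum_norm_le) (auto simp: norm_mult intro!: mult_left_mono mp)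
  then have "ennreal (cmod (\<Sum>J\<in>F. c J z * mpow n (\<lambda>k. f k z) J)) \<le> ennreal (?\<tau> ^ x * (\<Sum>J\<in>F. cmod (c J z)))"
    unfolding sum_distrib_right[symmetric] by (intro ennreal_leI) (simp only: mult.commute)
  also have "\<dots> = (ennreal (max 1 (cmod (f 0 z))) * ennreal M) ^ x * ?S"
    using M by (simp add: ennreal_mult sum_nonneg flip: ennreal_power)
  finally have "lnplus (ennreal (cmod (\<Sum>J\<in>F. c J z * mpow n (\<lambda>k. f k z) J))) \<le> lnplus \<dots>" by (rule lnplus_mono)
  also have "\<dots> \<le> of_nat x * (lnplus (ennreal (max 1 (cmod (f 0 z)))) + ?\<Lambda>) + lnplus ?S"
    by (intro order.trans[OF lnplus_mult_le] add_mono order.trans[OF lnplus_power_le] mult_left_mono M order_refl) auto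
  finally show ?thesis by (simp add: lnplus_max_one)
qed

text \<open>\<open>prox_nn\<close> without its log^+: pointwise inequalities between sums of
  logarithms can be averaged term by term.\<close>

definition sphere_mean :: "real \<Rightarrow> (complex^'m \<Rightarrow> ennreal) \<Rightarrow> ennreal" where
  "sphere_mean r \<psi> = (\<integral>\<^sup>+x\<in>ball 0 1. \<psi> ((r / norm x) *\<^sub>R x) \<partial>lborel) / emeasure lborel (ball (0::complex^'m) 1)"

lemma prox_nn_eq_sphere_mean: "prox_nn r \<phi> = sphere_mean r (\<lambda>z. lnplus (\<phi> z))"
  by (simp add: prox_nn_def sphere_mean_def)

lemma sphere_mean_add:
  assumes [measurable]: "\<phi> \<in> borel_measurable borel" "\<psi> \<in> borel_measurable borel"
  shows "sphere_mean r (\<lambda>z. \<phi> z + \<psi> z) = sphere_mean r \<phi> + sphere_mean r \<psi>"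
  unfolding sphere_mean_def distrib_right
  by (subst nn_integral_add) (auto simp: divide_ennreal_def distrib_right)

lemma sphere_mean_cmult:
  assumes [measurable]: "\<phi> \<in> borel_measurable borel"
  shows "sphere_mean r (\<lambda>z. c * \<phi> z) = c * sphere_mean r \<phi>"
  unfolding sphere_mean_def mult.assoc
  by (subst nn_integral_cmult) (auto simp: divide_ennreal_def mult.assoc)

lemma sphere_mean_const: "sphere_mean r (\<lambda>z::complex^'m. c) = c"
proof -
  have "c * emeasure lborel (ball (0::complex^'m) 1) / emeasure lborel (ball (0::complex^'m) 1) = c"
    using emeasure_unit_ball[where 'a="complex^'m"] by (intro ennreal_mult_divide_eq) auto
  then show ?thesis by (simp add: sphere_mean_def nn_integral_cmult_indicator)
qed

lemma sphere_mean_sum: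
  assumes "finite S" "\<And>i. i \<in> S \<Longrightarrow> \<phi> i \<in> borel_measurable borel"
  shows "sphere_mean r (\<lambda>z. \<Sum>i\<in>S. \<phi> i z) = (\<Sum>i\<in>S. sphere_mean r (\<phi> i))"
  using assms
proof (induction S rule: finite_induct)
  case (insert i S)
  then show ?case using sphere_mean_add[of "\<phi> i" "\<lambda>z. \<Sum>i\<in>S. \<phi> i z" r] by simp
qed (simp add: sphere_mean_def)

lemma sphere_mean_mono_AE:
  fixes \<phi> \<psi> :: "complex^'m \<Rightarrow> ennreal"
  assumes "AE x in lborel. x \<in> ball 0 1 \<longrightarrow> \<phi> ((r / norm x) *\<^sub>R x) \<le> \<psi> ((r / norm x) *\<^sub>R x)"
  shows "sphere_mean r \<phi> \<le> sphere_mean r \<psi>"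
  unfolding sphere_mean_def
proof (intro divide_right_mono_ennreal nn_integral_mono_AE)
  show "AE x in lborel. \<phi> ((r / norm x) *\<^sub>R x) * indicator (ball 0 1) x \<le> \<psi> ((r / norm x) *\<^sub>R x) * indicator (ball 0 1) x"
    using assms by eventually_elim (auto simp: indicator_def)
qed

lemma sphere_mean_mono: "(\<And>z. \<phi> z \<le> \<psi> z) \<Longrightarrow> sphere_mean r \<phi> \<le> sphere_mean r \<psi>"
  by (intro sphere_mean_mono_AE AE_I2) auto

section \<open>Comparison of proximity functions\<close>

text \<open>The lower and the upper estimate of \<open>P\<close> are averaged and joined by the
  Jensen inequality for \<open>P\<close>. What matters is \<open>N\<close> on the left against
  \<open>9 * x\<close> on the right; the remaining terms will be small.\<close>

lemma prox_inverse_le_of_gap: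
  fixes f :: "nat \<Rightarrow> complex^'m \<Rightarrow> complex" and a :: "(nat \<Rightarrow> nat) \<Rightarrow> complex^'m \<Rightarrow> complex"
  assumes n: "n \<ge> 1" and f_entire: "\<And>i. i < n \<Longrightarrow> entire_m (f i)" and f0: "f 0 b \<noteq> 0"
    and a_entire: "\<And>I. I \<in> multi_idx n \<Longrightarrow> entire_m (a I)"
    and G_conv: "\<And>z. summable (ps_part n a z (\<lambda>k. f k z))"
    and G_zero: "\<And>z. (\<Sum>d. ps_part n a z (\<lambda>k. f k z) d) = 0"
    and L: "L \<le> N" and x: "x \<le> N"
    and R: "\<And>K. K \<in> multi_idx n \<Longrightarrow> mdeg n K < L \<Longrightarrow> R K \<in> poly_ring_of (a ` multi_idx n)"
    and gap: "\<And>J. J \<in> multi_idx n \<Longrightarrow> x \<le> mdeg n J \<Longrightarrow> mdeg n J < N \<Longrightarrow> conv_coeff n L R a J = (\<lambda>z. 0)"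
    and P: "P = (\<lambda>z. \<Sum>J\<in>{J\<in>multi_idx n. mdeg n J < x}. conv_coeff n L R a J z * mpow n (\<lambda>k. f k z) J)"
    and Pnz: "P p \<noteq> 0"
  obtains C c d where "C < \<infinity>"
    "\<And>r. 2 \<le> r \<Longrightarrow> of_nat N * prox_nn r (\<lambda>z. ennreal (cmod (inverse (f 0 z))))
        \<le> of_nat (9 * x) * prox_nn r (\<lambda>z. ennreal (cmod (f 0 z)))
         + of_nat c * (\<Sum>i<n. prox_nn r (\<lambda>z. ennreal (cmod (f i z / f 0 z))))
         + of_nat d * prox_nn r (coeff_norm n a) + C"
proof -
  let ?F = "{J\<in>multi_idx n. mdeg n J < x}" and ?U = "{K\<in>multi_idx n. mdeg n K < L}"
  let ?c = "conv_coeff n L R a"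
  let ?A = "\<lambda>z. lnplus (coeff_norm n a z)"
  let ?\<Lambda> = "\<lambda>z. \<Sum>i<n. lnplus (ennreal (cmod (f i z / f 0 z)))"
  have cA: "?c J \<in> poly_ring_of (a ` multi_idx n)" if "J \<in> multi_idx n" for J
    by (rule conv_coeff_in_poly_ring_of[OF R that])
  have P_entire: "entire_m P"
    unfolding P mpow_def using f_entire a_entire
    by (intro entire_m_sum entire_m_mult entire_m_prod entire_m_power entire_m_poly_ring_of[OF cA]) auto
  have f0_entire: "entire_m (f 0)" using f_entire n by simp
  note [measurable] = entire_m_measurable[OF P_entire] entire_m_measurable[OF f0_entire]
  have [measurable]: "f i \<in> borel_measurable borel" if "i < n" for i
    by (rule entire_m_measurable[OF f_entire[OF that]])
  have [measurable]: "(\<lambda>z. lnplus (ennreal (cmod (f i z / f 0 z)))) \<in> borel_measurable borel" if "i < n" for i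
    using that by measurable
  have \<Lambda>_meas [measurable]: "?\<Lambda> \<in> borel_measurable borel" by (intro borel_measurable_sum) auto
  have [measurable]: "coeff_norm n a \<in> borel_measurable borel"
    unfolding coeff_norm_def[abs_def] using entire_m_measurable[OF a_entire]
    by (intro borel_measurable_suminf_order borel_measurable_sum measurable_compose[OF _ measurable_ennreal]
        borel_measurable_norm) auto
  obtain C1 s1 where C1: "C1 < \<infinity>" "\<And>z. lnplus (\<Sum>K\<in>?U. ennreal (cmod (R K z))) \<le> C1 + of_nat s1 * ?A z"
    using lnplus_sum_poly_ring_of[OF finite_multi_idx_less, of n L R a n] R by auto
  obtain C2 s2 where C2: "C2 < \<infinity>" "\<And>z. lnplus (\<Sum>J\<in>?F. ennreal (cmod (?c J z))) \<le> C2 + of_nat s2 * ?A z"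
    using lnplus_sum_poly_ring_of[OF finite_multi_idx_less, of n x ?c a n] cA by auto
  obtain C3 where C3: "C3 < \<infinity>"
    "\<And>r. 2 \<le> r \<Longrightarrow> prox_nn r (\<lambda>z. inverse (ennreal (cmod (P z)))) \<le> 9 * prox_nn r (\<lambda>z. ennreal (cmod (P z))) + C3"
    using prox_nn_inverse_le[OF P_entire Pnz] by blast
  \<comment> \<open>Thanks to the gap the same \<open>P\<close> is a sum over degrees below
    \<open>x\<close>, for the upper bound, and below \<open>N\<close>, for the order of
    smallness.\<close>
  have P_N: "P z = (\<Sum>J\<in>{J\<in>multi_idx n. mdeg n J < N}. ?c J z * mpow n (\<lambda>k. f k z) J)" for z
    unfolding P using x gap by (intro sum.mono_neutral_left finite_multi_idx_less) (auto simp: not_less)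
  have lower: "of_nat N * lnplus (ennreal (cmod (inverse (f 0 z))))
      \<le> lnplus (inverse (ennreal (cmod (P z)))) + of_nat N * ?\<Lambda> z + of_nat (s1 + 1) * ?A z + C1" for z
  proof -
    have "of_nat N * lnplus (ennreal (cmod (inverse (f 0 z))))
      \<le> lnplus (inverse (ennreal (cmod (P z)))) + of_nat N * ?\<Lambda> z + lnplus (\<Sum>K\<in>?U. ennreal (cmod (R K z))) + ?A z"
      by (rule lnplus_inverse_gap_polynomial[OF L G_conv G_zero P_N])
    also have "\<dots> \<le> lnplus (inverse (ennreal (cmod (P z)))) + of_nat N * ?\<Lambda> z + (C1 + of_nat s1 * ?A z) + ?A z"
      by (intro add_mono order_refl C1)
    finally show ?thesis by (simp add: distrib_right add_ac)
  qed
  have upper: "lnplus (ennreal (cmod (P z))) \<le> of_nat x * (lnplus (ennreal (cmod (f 0 z))) + ?\<Lambda> z) + (C2 + of_nat s2 * ?A z)"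
    if "f 0 z \<noteq> 0" for z
    unfolding P by (intro order.trans[OF lnplus_polynomial_le[of f z, OF that finite_multi_idx_less]] add_mono order_refl C2(2)) auto
  \<comment> \<open>The Jensen factor 9 multiplies what comes from the upper bound of
    \<open>P\<close>: the quotients enter \<open>N\<close> times through the order of smallness and
    \<open>9 * x\<close> times through the degree.\<close>
  show ?thesis
  proof (rule that[of "9 * C2 + C3 + C1" "N + 9 * x" "s1 + 1 + 9 * s2"])
    show "9 * C2 + C3 + C1 < \<infinity>" using C1 C2 C3 by (simp add: ennreal_mult_less_top)
    fix r :: real assume r: "2 \<le> r"
    define T where "T = prox_nn r (\<lambda>z. ennreal (cmod (f 0 z)))"
    define Q where "Q = (\<Sum>i<n. prox_nn r (\<lambda>z. ennreal (cmod (f i z / f 0 z))))"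
    define S where "S = prox_nn r (coeff_norm n a)"
    have Q: "sphere_mean r ?\<Lambda> = Q"
      unfolding Q_def prox_nn_eq_sphere_mean by (subst sphere_mean_sum) auto
    have "of_nat N * prox_nn r (\<lambda>z. ennreal (cmod (inverse (f 0 z)))) =
        sphere_mean r (\<lambda>z. of_nat N * lnplus (ennreal (cmod (inverse (f 0 z)))))"
      unfolding prox_nn_eq_sphere_mean by (subst sphere_mean_cmult) auto
    also have "\<dots> \<le> sphere_mean r (\<lambda>z. lnplus (inverse (ennreal (cmod (P z)))) + of_nat N * ?\<Lambda> z + of_nat (s1 + 1) * ?A z + C1)"
      by (rule sphere_mean_mono[OF lower])
    also have "\<dots> = prox_nn r (\<lambda>z. inverse (ennreal (cmod (P z)))) + of_nat N * Q + of_nat (s1 + 1) * S + C1"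
      unfolding S_def prox_nn_eq_sphere_mean Q[symmetric]
      by (simp add: sphere_mean_add sphere_mean_cmult sphere_mean_const del: of_nat_add of_nat_Suc)
    also have "\<dots> \<le> (9 * prox_nn r (\<lambda>z. ennreal (cmod (P z))) + C3) + of_nat N * Q + of_nat (s1 + 1) * S + C1"
      by (intro add_mono order_refl C3(2) r)
    also have "prox_nn r (\<lambda>z. ennreal (cmod (P z))) \<le>
        sphere_mean r (\<lambda>z. of_nat x * (lnplus (ennreal (cmod (f 0 z))) + ?\<Lambda> z) + (C2 + of_nat s2 * ?A z))"
      unfolding prox_nn_eq_sphere_mean
    proof (rule sphere_mean_mono_AE)
      show "AE y in lborel. y \<in> ball 0 1 \<longrightarrow> lnplus (ennreal (cmod (P ((r / norm y) *\<^sub>R y)))) \<le>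
          of_nat x * (lnplus (ennreal (cmod (f 0 ((r / norm y) *\<^sub>R y)))) + ?\<Lambda> ((r / norm y) *\<^sub>R y)) +
          (C2 + of_nat s2 * ?A ((r / norm y) *\<^sub>R y))"
        using entire_m_AE_nonzero_sphere[OF f0_entire f0 r] by eventually_elim (use upper in blast)
    qed
    also have "sphere_mean r (\<lambda>z. of_nat x * (lnplus (ennreal (cmod (f 0 z))) + ?\<Lambda> z) + (C2 + of_nat s2 * ?A z)) =
        of_nat x * (T + Q) + (C2 + of_nat s2 * S)"
      unfolding T_def S_def prox_nn_eq_sphere_mean Q[symmetric]
      by (simp add: sphere_mean_add sphere_mean_cmult sphere_mean_const)
    finally have "of_nat N * prox_nn r (\<lambda>z. ennreal (cmod (inverse (f 0 z)))) \<le>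
      9 * (of_nat x * (T + Q) + (C2 + of_nat s2 * S)) + C3 + of_nat N * Q + of_nat (s1 + 1) * S + C1"
      by (simp add: add_mono mult_left_mono)
    also have "\<dots> = of_nat (9 * x) * T + of_nat (N + 9 * x) * Q + of_nat (s1 + 1 + 9 * s2) * S + (9 * C2 + C3 + C1)"
      by (simp add: distrib_left distrib_right mult.assoc add_ac)
    finally show "of_nat N * prox_nn r (\<lambda>z. ennreal (cmod (inverse (f 0 z)))) \<le>
      of_nat (9 * x) * prox_nn r (\<lambda>z. ennreal (cmod (f 0 z)))
         + of_nat (N + 9 * x) * (\<Sum>i<n. prox_nn r (\<lambda>z. ennreal (cmod (f i z / f 0 z))))
         + of_nat (s1 + 1 + 9 * s2) * prox_nn r (coeff_norm n a) + (9 * C2 + C3 + C1)"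
      unfolding T_def Q_def S_def .
  qed
qed

lemma prox_nn_eq_prox:
  assumes "prox_nn r (\<lambda>z. ennreal (cmod (h z))) < \<infinity>"
  shows "prox_nn r (\<lambda>z. ennreal (cmod (h z))) = ennreal (prox r h)"
  using assms by (simp add: prox_def)

lemma prox_nonneg: "0 \<le> prox r h"
  by (simp add: prox_def)

text \<open>The sides differ only at \<open>w = 0\<close>, where they are 0 and infinite: the defect
  uses the complex inverse, the Jensen inequality the extended one.\<close>

lemma lnplus_inverse_le: "lnplus (ennreal (cmod (inverse w))) \<le> lnplus (inverse (ennreal (cmod w)))"
  by (cases "w = 0") (simp_all add: inverse_ennreal norm_inverse)

lemma prox_nn_complex_inverse_finite:
  fixes h :: "complex^'m \<Rightarrow> complex"
  assumes "entire_m h" "h b \<noteq> 0" "2 \<le> r"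
  shows "prox_nn r (\<lambda>z. ennreal (cmod (inverse (h z)))) < \<infinity>"
proof -
  have "prox_nn r (\<lambda>z. ennreal (cmod (inverse (h z)))) \<le> prox_nn r (\<lambda>z. inverse (ennreal (cmod (h z))))"
    unfolding prox_nn_eq_sphere_mean by (intro sphere_mean_mono lnplus_inverse_le)
  also have "\<dots> < \<infinity>" by (rule prox_nn_inverse_finite[OF assms])
  finally show ?thesis .
qed

lemma prox_nn_divide_finite:
  fixes h :: "complex^'m \<Rightarrow> complex"
  assumes "entire_m g" "entire_m h" "h b \<noteq> 0" "2 \<le> r"
  shows "prox_nn r (\<lambda>z. ennreal (cmod (g z / h z))) < \<infinity>"
proof -
  note [measurable] = entire_m_measurable[OF assms(1)] entire_m_measurable[OF assms(2)]
  have "prox_nn r (\<lambda>z. ennreal (cmod (g z / h z))) \<le>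
      sphere_mean r (\<lambda>z. lnplus (ennreal (cmod (g z))) + lnplus (ennreal (cmod (inverse (h z)))))"
    unfolding prox_nn_eq_sphere_mean
  proof (rule sphere_mean_mono)
    fix z
    have "ennreal (cmod (g z / h z)) = ennreal (cmod (g z)) * ennreal (cmod (inverse (h z)))"
      by (simp add: divide_inverse norm_mult ennreal_mult del: norm_inverse)
    then show "lnplus (ennreal (cmod (g z / h z))) \<le> lnplus (ennreal (cmod (g z))) + lnplus (ennreal (cmod (inverse (h z))))"
      by (simp only: lnplus_mult_le)
  qed
  also have "\<dots> = prox_nn r (\<lambda>z. ennreal (cmod (g z))) + prox_nn r (\<lambda>z. ennreal (cmod (inverse (h z))))"
    unfolding prox_nn_eq_sphere_mean by (rule sphere_mean_add) measurable
  also have "\<dots> < \<infinity>" using prox_nn_finite[OF assms(1), of r] prox_nn_complex_inverse_finite[OF assms(2-4)] by simp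
  finally show ?thesis .
qed

theorem mainTheorem7:
  fixes n :: nat
    and f :: "nat \<Rightarrow> complex^'m \<Rightarrow> complex"
    and a :: "(nat \<Rightarrow> nat) \<Rightarrow> complex^'m \<Rightarrow> complex"
  assumes n_pos: "n \<ge> 1"
    and f_entire: "\<And>i. i < n \<Longrightarrow> entire_m (f i)"
    and f_nonconst: "\<And>i. i < n \<Longrightarrow> nonconstant (f i)"
    and f_quot_small: "\<And>i. i < n \<Longrightarrow> is_S (f 0) (\<lambda>r. prox r (\<lambda>z. f i z / f 0 z))"
    and a_entire: "\<And>I. I \<in> multi_idx n \<Longrightarrow> entire_m (a I)"
    and G_nonzero: "\<exists>I\<in>multi_idx n. a I \<noteq> (\<lambda>z. 0)"
    and a_small: "\<exists>g. is_S (f 0) g \<and>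
        (\<forall>r>0. prox_nn r (\<lambda>z. \<Sum>d. \<Sum>I\<in>{I\<in>multi_idx n. mdeg n I = d}. ennreal (cmod (a I z)))
                 = ennreal (g r))"
    and G_conv: "\<And>z. summable (ps_part n a z (\<lambda>k. f k z))"
    and defect_pos: "defect0 (f 0) > 0"
    and G_zero: "\<And>z. (\<Sum>d. ps_part n a z (\<lambda>k. f k z) d) = 0"
  shows "\<exists>F c. finite F \<and> F \<subseteq> multi_idx n
           \<and> (\<forall>J\<in>F. c J \<in> poly_ring_of (a ` multi_idx n))
           \<and> (\<exists>J\<in>F. c J \<noteq> (\<lambda>z. 0))
           \<and> (\<forall>z. (\<Sum>J\<in>F. c J z * mpow n (\<lambda>k. f k z) J) = 0)"
proof -
  have f0_entire: "entire_m (f 0)" using f_entire n_pos by simp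
  have f0_nc: "nonconstant (f 0)" using f_nonconst n_pos by simp
  then obtain b where b: "f 0 b \<noteq> 0" unfolding nonconstant_def by blast
  define T where "T r = prox r (f 0)" for r
  \<comment> \<open>A real number strictly below the defect, which is an extended real.\<close>
  obtain \<delta> where \<delta>: "0 < \<delta>" "ereal \<delta> < defect0 (f 0)"
    using ereal_dense2[OF defect_pos] by auto
  have ev_\<delta>: "\<forall>\<^sub>F r in at_top. \<delta> < prox r (\<lambda>z. inverse (f 0 z)) / T r"
    using less_LiminfD[OF \<delta>(2)[unfolded defect0_def]] by (simp add: T_def char_T_def)
  \<comment> \<open>Here 10 is 9 from the Jensen inequality plus 1 to absorb the error terms, which
    eventually fall below \<open>T r\<close> outside the exceptional set.\<close>
  define \<kappa> where "\<kappa> = nat \<lceil>10 / \<delta>\<rceil>"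
  have "10 / \<delta> \<le> real \<kappa>" unfolding \<kappa>_def by linarith
  then have \<kappa>: "10 \<le> real \<kappa> * \<delta>" using \<delta>(1) by (simp add: pos_divide_le_eq)
  then have \<kappa>1: "\<kappa> \<ge> 1" by (cases \<kappa>) auto
  obtain x L R where x: "x \<ge> 1" and L: "L \<le> \<kappa> * x"
    and R: "\<And>K. K \<in> multi_idx n \<Longrightarrow> mdeg n K < L \<Longrightarrow> R K \<in> poly_ring_of (a ` multi_idx n)"
    and gap: "\<And>J. J \<in> multi_idx n \<Longrightarrow> x \<le> mdeg n J \<Longrightarrow> mdeg n J < \<kappa> * x \<Longrightarrow> conv_coeff n L R a J = (\<lambda>z. 0)"
    and nz: "\<exists>J\<in>multi_idx n. mdeg n J < x \<and> conv_coeff n L R a J \<noteq> (\<lambda>z. 0)"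
    using ex_multiplier_with_gap[OF n_pos \<kappa>1 a_entire G_nonzero] by blast
  define N where "N = \<kappa> * x"
  define P where "P = (\<lambda>z. \<Sum>J\<in>{J\<in>multi_idx n. mdeg n J < x}. conv_coeff n L R a J z * mpow n (\<lambda>k. f k z) J)"
  have "P z = 0" for z
  proof (rule ccontr)
    assume Pz: "P z \<noteq> 0"
    have "x \<le> N" using \<kappa>1 by (simp add: N_def)
    obtain C c d where C: "C < \<infinity>" and key:
      "\<And>r. 2 \<le> r \<Longrightarrow> of_nat N * prox_nn r (\<lambda>z. ennreal (cmod (inverse (f 0 z))))
        \<le> of_nat (9 * x) * prox_nn r (\<lambda>z. ennreal (cmod (f 0 z)))
         + of_nat c * (\<Sum>i<n. prox_nn r (\<lambda>z. ennreal (cmod (f i z / f 0 z))))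
         + of_nat d * prox_nn r (coeff_norm n a) + C"
      by (rule prox_inverse_le_of_gap[OF n_pos f_entire b a_entire G_conv G_zero L[folded N_def] \<open>x \<le> N\<close> R gap[folded N_def] P_def Pz])
        (assumption | rule that)+
    obtain C' where C': "C = ennreal C'" "0 \<le> C'" using C by (cases C rule: ennreal_cases) auto
    obtain g where g: "is_S (f 0) g" "\<And>r. 0 < r \<Longrightarrow> prox_nn r (coeff_norm n a) = ennreal (g r)"
      using a_small unfolding coeff_norm_def[abs_def] by blast
    define q where "q r = (\<Sum>i<n. prox r (\<lambda>z. f i z / f 0 z))" for r
    \<comment> \<open>The hypothesis fixes \<open>g r\<close> only through \<open>ennreal\<close>,
      which sends negative numbers to 0; hence the \<open>max 0\<close>.\<close>
    define e where "e r = real c * q r + real d * max 0 (g r) + C'" for r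
    have T0: "0 \<le> T r" for r by (simp add: T_def prox_nonneg)
    have q0: "0 \<le> q r" for r by (simp add: q_def sum_nonneg prox_nonneg)
    have real_key: "real N * prox r (\<lambda>z. inverse (f 0 z)) \<le> real (9 * x) * T r + e r" if r: "2 \<le> r" for r
    proof -
      have "(\<Sum>i<n. prox_nn r (\<lambda>z. ennreal (cmod (f i z / f 0 z)))) = (\<Sum>i<n. ennreal (prox r (\<lambda>z. f i z / f 0 z)))"
        using prox_nn_divide_finite[OF f_entire f0_entire b r] by (intro sum.cong prox_nn_eq_prox) auto
      also have "\<dots> = ennreal (q r)" unfolding q_def by (simp add: prox_nonneg)
      finally have qr: "(\<Sum>i<n. prox_nn r (\<lambda>z. ennreal (cmod (f i z / f 0 z)))) = ennreal (q r)" .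
      have gr: "prox_nn r (coeff_norm n a) = ennreal (max 0 (g r))" using g(2)[of r] r by (simp add: ennreal_max_0)
      have "ennreal (real N * prox r (\<lambda>z. inverse (f 0 z))) \<le> ennreal (real (9 * x) * T r + e r)"
        using key[OF r] T0[of r] q0[of r] C'(2)
        unfolding qr gr C'(1) prox_nn_eq_prox[OF prox_nn_complex_inverse_finite[OF f0_entire b r]]
          prox_nn_eq_prox[OF prox_nn_finite[OF f0_entire]] ennreal_of_nat_eq_real_of_nat
        by (simp add: e_def T_def[symmetric] ennreal_mult ennreal_plus prox_nonneg add.assoc)
      then show ?thesis using T0[of r] q0[of r] C'(2) by (subst (asm) ennreal_le_iff) (auto simp: e_def)
    qed
    obtain Eg where Eg: "Eg \<in> sets lebesgue" "emeasure lebesgue Eg < \<infinity>"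
      "((\<lambda>r. g r / T r) \<longlongrightarrow> 0) (inf at_top (principal (- Eg)))"
      using g(1) unfolding is_S_def T_def char_T_def by blast
    have "\<forall>i\<in>{..<n}. \<exists>E. E \<in> sets lebesgue \<and> emeasure lebesgue E < \<infinity> \<and>
      ((\<lambda>r. prox r (\<lambda>z. f i z / f 0 z) / T r) \<longlongrightarrow> 0) (inf at_top (principal (- E)))"
      using f_quot_small unfolding is_S_def T_def char_T_def by blast
    from bchoice[OF this] obtain Ef where Ef: "\<And>i. i < n \<Longrightarrow> Ef i \<in> sets lebesgue" "\<And>i. i < n \<Longrightarrow> emeasure lebesgue (Ef i) < \<infinity>"
      "\<And>i. i < n \<Longrightarrow> ((\<lambda>r. prox r (\<lambda>z. f i z / f 0 z) / T r) \<longlongrightarrow> 0) (inf at_top (principal (- Ef i)))"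
      by blast
    \<comment> \<open>The finitely many exceptional sets are merged. Their union has finite measure,
      so it contains no half-line and the filter \<open>Fl\<close> is proper.\<close>
    define E where "E = Eg \<union> (\<Union>i<n. Ef i)"
    define Fl where "Fl = inf at_top (principal (- E))"
    have "emeasure lebesgue E \<le> emeasure lebesgue Eg + emeasure lebesgue (\<Union>i<n. Ef i)"
      unfolding E_def using Eg Ef by (intro emeasure_subadditive) auto
    also have "emeasure lebesgue (\<Union>i<n. Ef i) \<le> (\<Sum>i<n. emeasure lebesgue (Ef i))"
      using Ef by (intro emeasure_subadditive_finite) auto
    finally have "emeasure lebesgue E \<le> emeasure lebesgue Eg + (\<Sum>i<n. emeasure lebesgue (Ef i))"
      by (simp add: add_left_mono)
    also have "\<dots> < \<infinity>" using Eg(2) Ef(2) by simp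
    finally obtain m where m: "emeasure lebesgue E = ennreal m" "0 \<le> m"
      by (cases "emeasure lebesgue E" rule: ennreal_cases) auto
    have "Fl \<noteq> bot"
    proof
      assume "Fl = bot"
      then have "\<forall>\<^sub>F r in at_top. r \<in> E"
        unfolding Fl_def trivial_limit_def eventually_inf_principal by simp
      then obtain r0 where "{r0..} \<subseteq> E" by (auto simp: eventually_at_top_linorder)
      moreover have "E \<in> sets lebesgue" unfolding E_def using Eg Ef by auto
      ultimately have "emeasure lebesgue {r0..r0 + m + 1} \<le> emeasure lebesgue E"
        by (intro emeasure_mono) auto
      then show False using m by (simp add: ennreal_le_iff)
    qed
    have "Fl \<le> at_top" unfolding Fl_def by simp
    have lim_g: "((\<lambda>r. g r / T r) \<longlongrightarrow> 0) Fl"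
      by (rule tendsto_mono[OF _ Eg(3)]) (unfold Fl_def E_def, intro inf_mono order_refl, auto)
    have lim_f: "((\<lambda>r. prox r (\<lambda>z. f i z / f 0 z) / T r) \<longlongrightarrow> 0) Fl" if "i < n" for i
      by (rule tendsto_mono[OF _ Ef(3)[OF that]]) (unfold Fl_def E_def, intro inf_mono order_refl, use that in auto)
    \<comment> \<open>The unbounded characteristic makes the constant \<open>C'\<close>
      negligible.\<close>
    have "filterlim T at_top Fl"
      using filterlim_prox_at_top[OF f0_entire f0_nc] unfolding T_def
      by (rule filterlim_mono) (auto simp: \<open>Fl \<le> at_top\<close>)
    then have lim_T: "((\<lambda>r. inverse (T r)) \<longlongrightarrow> 0) Fl" by (rule tendsto_inverse_0_at_top)
    have "((\<lambda>r. real c * (\<Sum>i<n. prox r (\<lambda>z. f i z / f 0 z) / T r) + real d * max 0 (g r / T r) + C' * inverse (T r))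
        \<longlongrightarrow> real c * (\<Sum>i<n. 0) + real d * max 0 0 + C' * 0) Fl"
      by (intro tendsto_intros lim_g lim_f lim_T) auto
    moreover have "real c * (\<Sum>i<n. prox r (\<lambda>z. f i z / f 0 z) / T r) + real d * max 0 (g r / T r) + C' * inverse (T r) = e r / T r" for r
    proof -
      have "max 0 (g r / T r) = max 0 (g r) / T r"
        using T0[of r] by (cases "T r = 0") (auto simp: max_def zero_le_divide_iff)
      then show ?thesis
        unfolding e_def q_def sum_divide_distrib[symmetric] by (simp add: add_divide_distrib inverse_eq_divide)
    qed
    ultimately have "((\<lambda>r. e r / T r) \<longlongrightarrow> 0) Fl" by simp
    then have "\<forall>\<^sub>F r in Fl. e r / T r < 1" by (rule order_tendstoD) simp
    moreover have "\<forall>\<^sub>F r in Fl. \<delta> < prox r (\<lambda>z. inverse (f 0 z)) / T r"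
      using ev_\<delta> \<open>Fl \<le> at_top\<close> by (rule filter_leD[rotated])
    moreover have "\<forall>\<^sub>F r in Fl. 2 \<le> r"
      using eventually_ge_at_top \<open>Fl \<le> at_top\<close> by (rule filter_leD[rotated])
    ultimately have "\<forall>\<^sub>F r in Fl. False"
    proof eventually_elim
      case (elim r)
      \<comment> \<open>Division by 0 yields 0, so a positive lower bound of the quotient excludes
        \<open>T r = 0\<close>.\<close>
      have "T r \<noteq> 0" using elim(2) \<delta>(1) by auto
      then have T: "0 < T r" using T0[of r] by simp
      have "10 * real x * T r \<le> real \<kappa> * \<delta> * real x * T r"
        using \<kappa> T by (intro mult_right_mono) auto
      also have "\<dots> = real N * (\<delta> * T r)" by (simp add: N_def)
      also have "\<dots> \<le> real N * prox r (\<lambda>z. inverse (f 0 z))"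
        using elim(2) T by (intro mult_left_mono) (auto simp: field_simps)
      also have "\<dots> \<le> real (9 * x) * T r + e r" by (rule real_key[OF elim(3)])
      also have "\<dots> < real (9 * x) * T r + T r" using elim(1) T by (simp add: field_simps)
      also have "\<dots> \<le> 10 * real x * T r" using x T by (simp add: algebra_simps)
      finally show False by simp
    qed
    with \<open>Fl \<noteq> bot\<close> show False by (simp add: trivial_limit_def)
  qed
  moreover have "conv_coeff n L R a J \<in> poly_ring_of (a ` multi_idx n)" if "J \<in> multi_idx n" for J
    by (rule conv_coeff_in_poly_ring_of[OF R that])
  ultimately show ?thesis
    using nz unfolding P_def
    by (intro exI[of _ "{J\<in>multi_idx n. mdeg n J < x}"] exI[of _ "conv_coeff n L R a"])
       (auto simp: finite_multi_idx_less)
qed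

end
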